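(* Let $(W,S)$ be an affine Coxeter system of rank two and $\rho$ any representation of $H_q(W,S)$. Then there is an ordering of the collection $$\{H_1(\rho,u),\ H_2(\rho,u)\}\cup\{W_I(\rho,u)^{(-1)^{|I|}}: I\subsetneq S\}$$ such that the product of its members in this order equals $W(\rho,u)$ in $\mathrm{End}(V_\rho)[[u]]$.
   Context: Let $(W,S)$, $S=\{s_1,s_2,s_3\}$, be an affine Coxeter system of rank two, where $m_{ij}$ denotes the order of $s_is_j$, labelled so that $(m_{12},m_{23},m_{13})$ equals $(3,3,3)$ (type $\tilde A_2$), $(4,2,4)$ (type $\tilde C_2$) or $(6,2,3)$ (type $\tilde G_2$); $\ell$ is the length function and $W_I$ the subgroup generated by $I\subseteq S$. Define: in type $\tilde A_2$, $w_1=s_3s_2s_1$, $w_2=s_3s_1s_2$; in type $\tilde C_2$, $w_1=s_3s_1s_2s_1$, $w_2=s_3s_1s_2$; in type $\tilde G_2$, $w_1=s_3s_1s_2$, $w_2=s_3s_1s_2s_1s_2$. Let $H_i=\{w_i^k:k\in\mathbb{Z}_{\ge0}\}$. The Hecke algebra $H_q(W,S)$ is the associative algebra with basis $\{e_w\}_{w\in W}$ and multiplication characterized by $(e_s+1)(e_s-q)=0$ for $s\in S$ and $e_we_v=e_{wv}$ whenever $\ell(wv)=\ell(w)+\ell(v)$. For a representation $(\rho,V_\rho)$ and $D\subseteq W$, $D(\rho,u)=\sum_{w\in D}\rho(e_w)u^{\ell(w)}\in\mathrm{End}(V_\rho)[[u]]$; when $e\in D$ its constant term is the identity, so it is invertible,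 which gives meaning to $W_I(\rho,u)^{-1}$. *)

theory Defs
  imports Complex_Main
begin

datatype afftype = TA2 | TC2 | TG2

definition Gens :: "nat set" where
  "Gens = {1, 2, 3}"

definition cox_m :: "afftype \<Rightarrow> nat \<Rightarrow> nat \<Rightarrow> nat" where
  "cox_m t i j =
     (if i = j then 1
      else if {i, j} = {1, 2} then (case t of TA2 \<Rightarrow> 3 | TC2 \<Rightarrow> 4 | TG2 \<Rightarrow> 6)
      else if {i, j} = {2, 3} then (case t of TA2 \<Rightarrow> 3 | TC2 \<Rightarrow> 2 | TG2 \<Rightarrow> 2)
      else (case t of TA2 \<Rightarrow> 3 | TC2 \<Rightarrow> 4 | TG2 \<Rightarrow> 3))"

fun alt :: "nat \<Rightarrow> nat \<Rightarrow> nat \<Rightarrow> nat list" where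
  "alt s r 0 = []"
| "alt s r (Suc k) = s # alt r s k"

inductive cox_eqv :: "afftype \<Rightarrow> nat list \<Rightarrow> nat list \<Rightarrow> bool" for t where
  refl: "cox_eqv t xs xs"
| sym: "cox_eqv t xs ys \<Longrightarrow> cox_eqv t ys xs"
| trans: "cox_eqv t xs ys \<Longrightarrow> cox_eqv t ys zs \<Longrightarrow> cox_eqv t xs zs"
| cancel: "s \<in> Gens \<Longrightarrow> cox_eqv t (xs @ [s, s] @ ys) (xs @ ys)"
| braid: "s \<in> Gens \<Longrightarrow> r \<in> Gens \<Longrightarrow>
     cox_eqv t (xs @ alt s r (cox_m t s r) @ ys) (xs @ alt r s (cox_m t s r) @ ys)"

text \<open>The element of W represented by a word (its equivalence class).\<close>
definition cls :: "afftype \<Rightarrow> nat list \<Rightarrow> nat list set" where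
  "cls t xs = {ys. cox_eqv t xs ys}"

definition Wsub :: "afftype \<Rightarrow> nat set \<Rightarrow> nat list set set" where
  "Wsub t I = {cls t xs | xs. set xs \<subseteq> I}"

definition Wgrp :: "afftype \<Rightarrow> nat list set set" where
  "Wgrp t = Wsub t Gens"

definition len :: "nat list set \<Rightarrow> nat" where
  "len w = (LEAST n. \<exists>xs\<in>w. length xs = n)"

definition wword :: "afftype \<Rightarrow> nat \<Rightarrow> nat list" where
  "wword t i = (case t of
       TA2 \<Rightarrow> (if i = 1 then [3,2,1] else [3,1,2])
     | TC2 \<Rightarrow> (if i = 1 then [3,1,2,1] else [3,1,2])
     | TG2 \<Rightarrow> (if i = 1 then [3,1,2] else [3,1,2,1,2]))"

definition Hset :: "afftype \<Rightarrow> nat \<Rightarrow> nat list set set" where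
  "Hset t i = {cls t (concat (replicate k (wword t i))) | k. True}"

text \<open>A representation of H_q(W,S) on a k-vector space V (given by scalar
  multiplication scale), described through the images rho(e_w) of the basis elements
  e_w, w in W: rho(e_w) are linear endomorphisms, rho(e_1) = id,
  (rho(e_s)+1)(rho(e_s)-q) = 0, and rho(e_w)rho(e_v) = rho(e_{wv}) when
  l(wv) = l(w) + l(v).  (These relations characterize the multiplication of H_q, so
  such maps are exactly the algebra representations.)\<close>
definition hecke_rep ::
  "afftype \<Rightarrow> ('k::field \<Rightarrow> 'v::ab_group_add \<Rightarrow> 'v) \<Rightarrow> 'k \<Rightarrow> (nat list set \<Rightarrow> 'v \<Rightarrow> 'v) \<Rightarrow> bool" where
  "hecke_rep t scale q \<rho> \<longleftrightarrow>
     (\<forall>w\<in>Wgrp t. Vector_Spaces.linear scale scale (\<rho> w)) \<and>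
     \<rho> (cls t []) = id \<and>
     (\<forall>s\<in>Gens. \<forall>x. \<rho> (cls t [s]) (\<rho> (cls t [s]) x) - scale q (\<rho> (cls t [s]) x)
                    + \<rho> (cls t [s]) x - scale q x = 0) \<and>
     (\<forall>xs ys. set xs \<subseteq> Gens \<longrightarrow> set ys \<subseteq> Gens \<longrightarrow>
        len (cls t (xs @ ys)) = len (cls t xs) + len (cls t ys) \<longrightarrow>
        \<rho> (cls t (xs @ ys)) = \<rho> (cls t xs) \<circ> \<rho> (cls t ys))"

text \<open>A power series in u is the sequence of its coefficients.\<close>
definition ps_one :: "nat \<Rightarrow> 'v \<Rightarrow> 'v::zero" where
  "ps_one n = (if n = 0 then id else (\<lambda>_. 0))"

definition ps_mult :: "(nat \<Rightarrow> 'v \<Rightarrow> 'v::comm_monoid_add) \<Rightarrow> (nat \<Rightarrow> 'v \<Rightarrow> 'v) \<Rightarrow> nat \<Rightarrow> 'v \<Rightarrow> 'v" where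
  "ps_mult A B n = (\<lambda>x. \<Sum>i\<le>n. A i (B (n - i) x))"

definition ps_inv :: "(nat \<Rightarrow> 'v \<Rightarrow> 'v::comm_monoid_add) \<Rightarrow> nat \<Rightarrow> 'v \<Rightarrow> 'v" where
  "ps_inv A = (THE B. ps_mult A B = ps_one \<and> ps_mult B A = ps_one)"

definition ps_prod :: "(nat \<Rightarrow> 'v \<Rightarrow> 'v::comm_monoid_add) list \<Rightarrow> nat \<Rightarrow> 'v \<Rightarrow> 'v" where
  "ps_prod As = foldr ps_mult As ps_one"

definition ser :: "(nat list set \<Rightarrow> 'v \<Rightarrow> 'v::comm_monoid_add) \<Rightarrow> nat list set set \<Rightarrow> nat \<Rightarrow> 'v \<Rightarrow> 'v" where
  "ser \<rho> D n = (\<lambda>x. \<Sum>w\<in>{w\<in>D. len w = n}. \<rho> w x)"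

text \<open>Index set of the collection: Inl i stands for H_i(rho,u) (i = 1,2),
  Inr I stands for W_I(rho,u)^((-1)^|I|) for I a proper subset of S.\<close>
definition factor_index :: "(nat + nat set) set" where
  "factor_index = Inl ` {1, 2} \<union> Inr ` {I. I \<subset> Gens}"

definition factor :: "afftype \<Rightarrow> (nat list set \<Rightarrow> 'v \<Rightarrow> 'v::comm_monoid_add) \<Rightarrow> nat + nat set \<Rightarrow> nat \<Rightarrow> 'v \<Rightarrow> 'v" where
  "factor t \<rho> a = (case a of
       Inl i \<Rightarrow> ser \<rho> (Hset t i)
     | Inr I \<Rightarrow> (if even (card I) then ser \<rho> (Wsub t I) else ps_inv (ser \<rho> (Wsub t I))))"

end

theory Submission
  imports Defs "HOL-Computational_Algebra.Formal_Power_Series"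
begin

text \<open>
  Write \<open>x, y, z\<close> for the series \<open>\<rho>(e\<^sub>1)u, \<rho>(e\<^sub>2)u, \<rho>(e\<^sub>3)u\<close>.  For \<open>I\<close> a proper subset of \<open>S\<close>,
  every \<open>w\<close> factors uniquely and length-additively as an element of \<open>W\<^sub>I\<close> times a minimal coset
  representative, so \<open>W\<^sub>I(\<rho>,u)\<^sup>-\<^sup>1 W(\<rho>,u)\<close> is the series of those \<open>w\<close> without left descents in \<open>I\<close>.
  As \<open>W\<close> is infinite, no element has all of \<open>S\<close> as left descents, and inclusion-exclusion gives
  \<open>Q W(\<rho>,u) = 1\<close> for \<open>Q = \<Sum> (-1)\<^bsup>|I|\<^esup> W\<^sub>I(\<rho>,u)\<^sup>-\<^sup>1\<close>, the sum ranging over the proper subsets of \<open>S\<close>.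
  The elements \<open>w\<^sub>1, w\<^sub>2\<close> are straight, so that \<open>H\<^sub>i(\<rho>,u)\<close> is the inverse of
  \<open>1 - \<rho>(e\<^bsub>w\<^sub>i\<^esub>)u\<^bsup>\<ell>(w\<^sub>i)\<^esup>\<close>.  For suitable products \<open>A, B\<close> of the \<open>W\<^sub>I(\<rho>,u)\<^sup>\<plusminus>\<^sup>1\<close>, an identity
  between noncommutative polynomials in \<open>x, y, z\<close> that uses only the braid relations factors
  \<open>A Q B\<close> into terms whose inverses belong to the collection, and \<open>W(\<rho>,u) = B (A Q B)\<^sup>-\<^sup>1 A\<close>.
  If \<open>s\<^sub>2\<close> and \<open>s\<^sub>3\<close> commute, the members not used in this way multiply to \<open>1\<close>.
\<close>

section \<open>Words and the elements they represent\<close>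

lemma Gens_members: "1 \<in> Gens" "2 \<in> Gens" "3 \<in> Gens"
  by (simp_all add: Gens_def)

lemma cox_eqv_context:
  assumes "cox_eqv t xs ys"
  shows "cox_eqv t (us @ xs @ vs) (us @ ys @ vs)"
  using assms
proof induction
  case (refl xs)
  show ?case by (rule cox_eqv.refl)
next
  case (sym xs ys)
  then show ?case by (blast intro: cox_eqv.sym)
next
  case (trans xs ys zs)
  then show ?case by (blast intro: cox_eqv.trans)
next
  case (cancel s xs ys)
  show ?case using cox_eqv.cancel[OF cancel, of t "us @ xs" "ys @ vs"] by simp
next
  case (braid s r xs ys)
  show ?case using cox_eqv.braid[OF braid, of t "us @ xs" "ys @ vs"] by simp
qed

lemma cls_eq_iff: "cls t xs = cls t ys \<longleftrightarrow> cox_eqv t xs ys"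
  unfolding cls_def by (blast intro: cox_eqv.refl cox_eqv.sym cox_eqv.trans)

lemma cls_append_cong:
  assumes "cls t xs = cls t xs'" "cls t ys = cls t ys'"
  shows "cls t (xs @ ys) = cls t (xs' @ ys')"
proof -
  have "cox_eqv t (xs @ ys) (xs' @ ys)"
    using cox_eqv_context[of t xs xs' "[]" ys] assms(1) by (simp add: cls_eq_iff)
  moreover have "cox_eqv t (xs' @ ys) (xs' @ ys')"
    using cox_eqv_context[of t ys ys' xs' "[]"] assms(2) by (simp add: cls_eq_iff)
  ultimately show ?thesis unfolding cls_eq_iff by (rule cox_eqv.trans)
qed

lemma cls_Cons_cong: "cls t xs = cls t ys \<Longrightarrow> cls t (s # xs) = cls t (s # ys)"
  using cls_append_cong[of t "[s]" "[s]" xs ys] by simp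

lemma cls_cancel: "s \<in> Gens \<Longrightarrow> cls t (s # s # xs) = cls t xs"
  unfolding cls_eq_iff using cox_eqv.cancel[of s t "[]" xs] by simp

lemma cls_braid:
  "s \<in> Gens \<Longrightarrow> r \<in> Gens \<Longrightarrow>
    cls t (alt s r (cox_m t s r)) = cls t (alt r s (cox_m t s r))"
  unfolding cls_eq_iff using cox_eqv.braid[of s r t "[]" "[]"] by simp

lemma cls_rev_append: "set us \<subseteq> Gens \<Longrightarrow> cls t (rev us @ us @ ys) = cls t ys"
proof (induction us arbitrary: ys)
  case (Cons s us)
  have "cls t (rev (s # us) @ (s # us) @ ys) = cls t (rev us @ s # s # us @ ys)"
    by simp
  also have "\<dots> = cls t (rev us @ us @ ys)"
    by (rule cls_append_cong[OF HOL.refl cls_cancel]) (use Cons.prems in auto)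
  also have "\<dots> = cls t ys"
    using Cons by simp
  finally show ?case .
qed simp

lemma set_alt: "set (alt s r k) \<subseteq> {s, r}"
  by (induction k arbitrary: s r) auto

lemma set_alt_subset_Gens: "s \<in> Gens \<Longrightarrow> r \<in> Gens \<Longrightarrow> set (alt s r k) \<subseteq> Gens"
  using set_alt[of s r k] by auto

lemma length_alt [simp]: "length (alt s r k) = k"
  by (induction k arbitrary: s r) auto

lemma cox_m_sym: "cox_m t s r = cox_m t r s"
  by (auto simp: cox_m_def insert_commute)

lemma cox_m_pos: "0 < cox_m t s r"
  by (auto simp: cox_m_def split: afftype.splits)

lemma cox_eqv_set_subset_Gens:
  "cox_eqv t xs ys \<Longrightarrow> set xs \<subseteq> Gens \<longleftrightarrow> set ys \<subseteq> Gens"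
proof (induction rule: cox_eqv.induct)
  case (braid s r xs ys)
  then show ?case using set_alt_subset_Gens[of s r] set_alt_subset_Gens[of r s] by auto
qed auto

lemma cox_eqv_even_length: "cox_eqv t xs ys \<Longrightarrow> even (length xs) = even (length ys)"
  by (induction rule: cox_eqv.induct) auto

lemma cls_Cons_alt:
  assumes "a \<in> Gens" "b \<in> Gens" "s \<in> {a, b}" "k \<le> cox_m t a b"
  obtains a' b' k' where "{a', b'} = {a, b}" "k' \<le> Suc k" "k' \<le> cox_m t a b"
    "cls t (s # alt a b k) = cls t (alt a' b' k')"
proof -
  consider (extend) "s = b" "k < cox_m t a b" | (exchange) "s = b" "k = cox_m t a b"
    | (singleton) "s = a" "k = 0" | (cancel) n where "s = a" "k = Suc n"
    using assms(3,4) by (cases k) (auto simp: le_less)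
  then show ?thesis
  proof cases
    case extend
    then show ?thesis by (intro that[of b a "Suc k"]) auto
  next
    case exchange
    then obtain n where n: "k = Suc n"
      using gr0_implies_Suc[OF cox_m_pos[of t a b]] by auto
    have "cls t (s # alt a b k) = cls t (b # alt b a k)"
      using exchange cls_Cons_cong[OF cls_braid[OF assms(1,2), of t]] by simp
    then have "cls t (s # alt a b k) = cls t (alt a b n)"
      using assms(2) n by (simp add: cls_cancel)
    then show ?thesis using n assms(4) by (intro that[of a b n]) auto
  next
    case singleton
    then show ?thesis using cox_m_pos[of t a b] by (intro that[of a b 1]) auto
  next
    case (cancel n)
    then show ?thesis using assms by (intro that[of b a n]) (auto simp: cls_cancel)
  qed
qed

lemma cls_eq_alt:
  assumes "s \<in> Gens" "r \<in> Gens" "set xs \<subseteq> {s, r}"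
  obtains a b k where "{a, b} = {s, r}" "k \<le> length xs" "k \<le> cox_m t s r"
    "cls t xs = cls t (alt a b k)"
  using assms(3)
proof (induction xs arbitrary: thesis)
  case Nil
  show ?case by (rule Nil.prems(1)[of s r 0]) auto
next
  case (Cons c xs)
  obtain a b k where k: "{a, b} = {s, r}" "k \<le> length xs" "k \<le> cox_m t s r"
      and eq: "cls t xs = cls t (alt a b k)"
    using Cons.IH Cons.prems(2) by auto
  then have ab: "a \<in> Gens" "b \<in> Gens" "c \<in> {a, b}" "cox_m t a b = cox_m t s r"
    using Cons.prems(2) assms by (auto simp: doubleton_eq_iff cox_m_sym)
  obtain a' b' k' where "{a', b'} = {a, b}" "k' \<le> Suc k" "k' \<le> cox_m t a b"
      "cls t (c # alt a b k) = cls t (alt a' b' k')"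
    by (rule cls_Cons_alt[OF ab(1-3), of k t]) (use k(3) ab(4) in simp_all)
  then show ?case
    using Cons.prems(1)[of a' b' k'] k(1,2) ab(4) cls_Cons_cong[OF eq, of c] by simp
qed

section \<open>Length and coset decompositions\<close>

lemma len_cls_le: "len (cls t xs) \<le> length xs"
  unfolding len_def cls_def by (rule Least_le) (auto intro: cox_eqv.refl)

lemma len_Nil [simp]: "len (cls t []) = 0"
  using len_cls_le[of t "[]"] by simp

lemma reduced_word_exists:
  assumes "set xs \<subseteq> Gens"
  obtains ys where "cls t ys = cls t xs" "length ys = len (cls t xs)" "set ys \<subseteq> Gens"
proof -
  have "\<exists>ys\<in>cls t xs. length ys = len (cls t xs)"
    unfolding len_def
    by (rule LeastI_ex) (auto simp: cls_def intro: cox_eqv.refl)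
  then obtain ys where ys: "cox_eqv t xs ys" "length ys = len (cls t xs)"
    by (auto simp: cls_def)
  then show ?thesis
    using that[of ys] assms cox_eqv_set_subset_Gens cls_eq_iff cox_eqv.sym by metis
qed

lemma len_eq_0_iff:
  assumes "set xs \<subseteq> Gens"
  shows "len (cls t xs) = 0 \<longleftrightarrow> cls t xs = cls t []"
proof
  assume "len (cls t xs) = 0"
  moreover obtain ys where "cls t ys = cls t xs" "length ys = len (cls t xs)"
    by (rule reduced_word_exists[OF assms])
  ultimately show "cls t xs = cls t []" by simp
qed simp

lemma len_append_le:
  assumes "set xs \<subseteq> Gens" "set ys \<subseteq> Gens"
  shows "len (cls t (xs @ ys)) \<le> len (cls t xs) + len (cls t ys)"
proof -
  obtain xs' where xs': "cls t xs' = cls t xs" "length xs' = len (cls t xs)"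
    by (rule reduced_word_exists[OF assms(1)])
  obtain ys' where ys': "cls t ys' = cls t ys" "length ys' = len (cls t ys)"
    by (rule reduced_word_exists[OF assms(2)])
  have "cls t (xs @ ys) = cls t (xs' @ ys')"
    by (rule cls_append_cong[OF xs'(1)[symmetric] ys'(1)[symmetric]])
  then show ?thesis
    using len_cls_le[of t "xs' @ ys'"] xs' ys' by simp
qed

lemma len_Cons_cases:
  assumes "s \<in> Gens" "set xs \<subseteq> Gens"
  shows "len (cls t (s # xs)) = Suc (len (cls t xs)) \<or> len (cls t xs) = Suc (len (cls t (s # xs)))"
proof -
  have le_Suc: "len (cls t (s # ys)) \<le> Suc (len (cls t ys))" if "set ys \<subseteq> Gens" for ys
    using len_append_le[of "[s]" ys t] len_cls_le[of t "[s]"] assms(1) that by simp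
  have Suc_ge: "len (cls t xs) \<le> Suc (len (cls t (s # xs)))"
    using le_Suc[of "s # xs"] assms cls_cancel[of s t xs] by simp
  obtain ys where ys: "cls t ys = cls t xs" "length ys = len (cls t xs)"
    by (rule reduced_word_exists[OF assms(2)])
  obtain zs where zs: "cls t zs = cls t (s # xs)" "length zs = len (cls t (s # xs))"
    by (rule reduced_word_exists[of "s # xs" t]) (use assms in auto)
  have "even (length zs) \<noteq> even (length ys)"
    using cox_eqv_even_length[of t zs "s # xs"] cox_eqv_even_length[of t ys xs] ys(1) zs(1)
    by (simp add: cls_eq_iff)
  then have "len (cls t (s # xs)) \<noteq> len (cls t xs)"
    using ys zs by auto
  then show ?thesis
    using le_Suc[OF assms(2)] Suc_ge by linarith
qed

definition left_ascent :: "afftype \<Rightarrow> nat \<Rightarrow> nat list \<Rightarrow> bool" where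
  "left_ascent t s xs \<longleftrightarrow> len (cls t xs) < len (cls t (s # xs))"

lemma left_ascent_cong: "cls t xs = cls t ys \<Longrightarrow> left_ascent t s xs \<longleftrightarrow> left_ascent t s ys"
  unfolding left_ascent_def using cls_Cons_cong by metis

lemma
  assumes "s \<in> Gens" "set xs \<subseteq> Gens"
  shows len_Cons_if_left_ascent:
      "left_ascent t s xs \<Longrightarrow> len (cls t (s # xs)) = Suc (len (cls t xs))"
    and len_Cons_if_not_left_ascent:
      "\<not> left_ascent t s xs \<Longrightarrow> len (cls t xs) = Suc (len (cls t (s # xs)))"
  using len_Cons_cases[OF assms, of t] by (auto simp: left_ascent_def)

lemma left_ascent_Cons_iff:
  assumes "s \<in> Gens" "set xs \<subseteq> Gens"
  shows "left_ascent t s (s # xs) \<longleftrightarrow> \<not> left_ascent t s xs"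
  using len_Cons_cases[OF assms, of t] cls_cancel[OF assms(1), of t xs]
  by (auto simp: left_ascent_def)

lemma left_descent_exists:
  assumes "set xs \<subseteq> Gens" "cls t xs \<noteq> cls t []"
  obtains s where "s \<in> Gens" "\<not> left_ascent t s xs"
proof -
  obtain ys where ys: "cls t ys = cls t xs" "length ys = len (cls t xs)" "set ys \<subseteq> Gens"
    by (rule reduced_word_exists[OF assms(1)])
  then obtain s zs where ys_Cons: "ys = s # zs"
    using assms(2) by (cases ys) auto
  have s: "s \<in> Gens"
    using ys(3) ys_Cons by simp
  have "cls t (s # xs) = cls t zs"
    using cls_Cons_cong[OF ys(1), of s] cls_cancel[OF s] ys_Cons by simp
  then have "\<not> left_ascent t s xs"
    using len_cls_le[of t zs] ys(2) ys_Cons by (simp add: left_ascent_def)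
  then show ?thesis using s that by blast
qed

lemma coset_decomposition:
  assumes "I \<subseteq> Gens" "set xs \<subseteq> Gens"
  obtains us vs where "set us \<subseteq> I" "set vs \<subseteq> Gens" "\<forall>s\<in>I. left_ascent t s vs"
    "cls t xs = cls t (us @ vs)" "len (cls t xs) = length us + len (cls t vs)"
  using assms(2)
proof (induction "len (cls t xs)" arbitrary: xs thesis rule: less_induct)
  case less
  show ?case
  proof (cases "\<forall>s\<in>I. left_ascent t s xs")
    case True
    then show ?thesis using less.prems by (intro less.prems(1)[of "[]" xs]) auto
  next
    case False
    then obtain s where s: "s \<in> I" "s \<in> Gens" "\<not> left_ascent t s xs"
      using assms(1) by blast
    have shorter: "len (cls t xs) = Suc (len (cls t (s # xs)))"
      by (rule len_Cons_if_not_left_ascent[OF s(2) less.prems(2) s(3)])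
    then obtain us vs where us: "set us \<subseteq> I" and vs: "set vs \<subseteq> Gens" "\<forall>s\<in>I. left_ascent t s vs"
      and eq: "cls t (s # xs) = cls t (us @ vs)"
      and len_eq: "len (cls t (s # xs)) = length us + len (cls t vs)"
      using less.hyps[of "s # xs"] s(2) less.prems(2) by auto
    have "cls t xs = cls t ((s # us) @ vs)"
      using cls_Cons_cong[OF eq, of s] cls_cancel[OF s(2), of t xs] by simp
    then show ?thesis
      using us vs s(1) shorter len_eq by (intro less.prems(1)[of "s # us" vs]) auto
  qed
qed

lemma cls_neq_Cons_if_left_ascent:
  assumes s: "s \<in> Gens" and ws: "set ws \<subseteq> Gens" "length ws < length us" and vs: "set vs \<subseteq> Gens"
    and reduced: "len (cls t (us @ vs)) = length us + len (cls t vs)"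
    and ascent: "left_ascent t s (us @ vs)"
  shows "cls t us \<noteq> cls t (s # ws)"
proof
  assume us_eq: "cls t us = cls t (s # ws)"
  have "cls t (s # us @ vs) = cls t (s # (s # ws) @ vs)"
    by (intro cls_Cons_cong cls_append_cong us_eq HOL.refl)
  also have "\<dots> = cls t (ws @ vs)"
    using s by (simp add: cls_cancel)
  finally have "len (cls t (s # us @ vs)) \<le> length ws + len (cls t vs)"
    using len_append_le[OF ws(1) vs, of t] len_cls_le[of t ws] by simp
  then show False
    using ascent reduced ws(2) by (simp add: left_ascent_def)
qed

lemma alternating_prefix_if_left_ascent:
  assumes s: "s \<in> Gens" and r: "r \<in> Gens" and us: "set us \<subseteq> {s, r}" and vs: "set vs \<subseteq> Gens"
    and reduced: "len (cls t (us @ vs)) = length us + len (cls t vs)"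
    and ascent: "left_ascent t s (us @ vs)"
  obtains k where "k < cox_m t s r" "cls t (us @ vs) = cls t (alt r s k @ vs)"
proof -
  obtain a b k where ab: "{a, b} = {s, r}" and k: "k \<le> length us" "k \<le> cox_m t s r"
      and us_eq: "cls t us = cls t (alt a b k)"
    by (rule cls_eq_alt[OF s r us])
  have append_eq: "cls t (us @ vs) = cls t (alt a b k @ vs)"
    by (rule cls_append_cong[OF us_eq HOL.refl])
  show ?thesis
  proof (cases k)
    case 0
    then show ?thesis using append_eq by (intro that[of 0]) (simp_all add: cox_m_pos)
  next
    case (Suc n)
    have not_s: "cls t us \<noteq> cls t (alt s r k)"
      using cls_neq_Cons_if_left_ascent[OF s set_alt_subset_Gens[OF r s] _ vs reduced ascent, of n]
        k(1) Suc by simp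
    then have ab: "a = r" "b = s"
      using us_eq ab by (auto simp: doubleton_eq_iff)
    moreover have "k \<noteq> cox_m t s r"
      using not_s us_eq ab cls_braid[OF s r, of t] by auto
    ultimately show ?thesis using k(2) append_eq by (intro that[of k]) simp_all
  qed
qed

section \<open>The geometric action\<close>

text \<open>The contragredient of the geometric representation, in coordinates given by the simple
  coroots; \<open>coef\<close> collects the negated off-diagonal entries of a Cartan matrix.  It acts on the
  integer vectors, and \<open>orbit\<close> follows the orbit of a dominant regular point.\<close>

definition coef :: "afftype \<Rightarrow> nat \<Rightarrow> nat \<Rightarrow> int" where
  "coef t s r = (if s \<notin> Gens \<or> r \<notin> Gens then 0 else case t of
       TA2 \<Rightarrow> 1
     | TC2 \<Rightarrow> (if s = 1 then 2 else if r = 1 then 1 else 0)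
     | TG2 \<Rightarrow> (if s = 1 then (if r = 2 then 3 else 1) else if r = 1 then 1 else 0))"

definition act :: "afftype \<Rightarrow> nat \<Rightarrow> (nat \<Rightarrow> int) \<Rightarrow> nat \<Rightarrow> int" where
  "act t s v = (\<lambda>r. if r = s then - v s else v r + coef t s r * v s)"

abbreviation act_word :: "afftype \<Rightarrow> nat list \<Rightarrow> (nat \<Rightarrow> int) \<Rightarrow> nat \<Rightarrow> int" where
  "act_word t xs v \<equiv> foldr (act t) xs v"

definition orbit :: "afftype \<Rightarrow> nat list \<Rightarrow> nat \<Rightarrow> int" where
  "orbit t xs = act_word t xs (\<lambda>_. 1)"

lemma orbit_Nil [simp]: "orbit t [] = (\<lambda>_. 1)"
  by (simp add: orbit_def)

lemma orbit_Cons: "orbit t (s # xs) = act t s (orbit t xs)"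
  by (simp add: orbit_def)

lemma orbit_append: "orbit t (xs @ ys) = act_word t xs (orbit t ys)"
  by (simp add: orbit_def)

lemma act_act: "act t s (act t s v) = v"
  by (auto simp: act_def)

lemma act_self: "act t s v s = - v s"
  by (simp add: act_def)

lemma alt_numeral:
  "alt s r 1 = [s]" "alt s r 2 = [s, r]" "alt s r 3 = [s, r, s]" "alt s r 4 = [s, r, s, r]"
  "alt s r 5 = [s, r, s, r, s]" "alt s r 6 = [s, r, s, r, s, r]"
  by (simp_all add: eval_nat_numeral)

lemma coef_cases:
  assumes "s \<in> Gens" "r \<in> Gens" "s \<noteq> r"
  obtains "cox_m t s r = 2" "coef t s r = 0" "coef t r s = 0"
    | "cox_m t s r = 3" "coef t s r = 1" "coef t r s = 1"
    | "cox_m t s r = 4" "coef t s r = 1" "coef t r s = 2"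
    | "cox_m t s r = 4" "coef t s r = 2" "coef t r s = 1"
    | "cox_m t s r = 6" "coef t s r = 1" "coef t r s = 3"
    | "cox_m t s r = 6" "coef t s r = 3" "coef t r s = 1"
  using assms by (cases t) (auto simp: cox_m_def coef_def Gens_def doubleton_eq_iff)

lemma act_word_braid:
  assumes "s \<in> Gens" "r \<in> Gens"
  shows "act_word t (alt s r (cox_m t s r)) v = act_word t (alt r s (cox_m t s r)) v"
proof (cases "s = r")
  case False
  show ?thesis
  proof
    fix i
    show "act_word t (alt s r (cox_m t s r)) v i = act_word t (alt r s (cox_m t s r)) v i"
      by (cases rule: coef_cases[OF assms False, of t]; cases "i = s"; cases "i = r")
        (use False in \<open>simp_all add: alt_numeral act_def algebra_simps\<close>)
  qed
qed simp

lemma act_word_cong: "cox_eqv t xs ys \<Longrightarrow> act_word t xs v = act_word t ys v"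
proof (induction arbitrary: v rule: cox_eqv.induct)
  case (cancel s xs ys)
  then show ?case by (simp add: act_act)
next
  case (braid s r xs ys)
  then show ?case by (simp add: act_word_braid)
qed auto

lemma orbit_cong: "cls t xs = cls t ys \<Longrightarrow> orbit t xs = orbit t ys"
  unfolding cls_eq_iff orbit_def by (rule act_word_cong)

lemma act_word_alt_pos:
  assumes "s \<in> Gens" "r \<in> Gens" "s \<noteq> r" "0 < v s" "0 < v r" "k < cox_m t s r"
  shows "0 < act_word t (alt r s k) v s"
proof -
  have "k < 6"
    using assms(6) by (auto simp: cox_m_def split: afftype.splits if_splits)
  then consider "k = 0" | "k = 1" | "k = 2" | "k = 3" | "k = 4" | "k = 5"
    by linarith
  then show ?thesis
    by cases (rule coef_cases[OF assms(1-3), of t]; use assms(3-6) in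
      \<open>simp add: alt_numeral act_def algebra_simps del: alt.simps(2) One_nat_def\<close>)+
qed

lemma orbit_pos_if_left_ascent:
  assumes "s \<in> Gens" "set xs \<subseteq> Gens" "left_ascent t s xs"
  shows "0 < orbit t xs s"
  using assms
proof (induction "len (cls t xs)" arbitrary: xs s rule: less_induct)
  case less
  note s = less.prems(1) and xs = less.prems(2) and ascent = less.prems(3)
  show ?case
  proof (cases "cls t xs = cls t []")
    case True
    then show ?thesis using orbit_cong[of t xs "[]"] by simp
  next
    case False
    obtain r where r: "r \<in> Gens" and descent: "\<not> left_ascent t r xs"
      by (rule left_descent_exists[OF xs False])
    have "s \<noteq> r"
      using ascent descent by blast
    obtain us vs where us: "set us \<subseteq> {s, r}" and vs: "set vs \<subseteq> Gens"
        and minimal: "\<forall>a\<in>{s, r}. left_ascent t a vs"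
        and xs_eq: "cls t xs = cls t (us @ vs)"
        and len_eq: "len (cls t xs) = length us + len (cls t vs)"
      by (rule coset_decomposition[of "{s, r}" xs t]) (use s r xs in auto)
    have "us \<noteq> []"
      using left_ascent_cong[OF xs_eq, of r] minimal descent by auto
    then have shorter: "len (cls t vs) < len (cls t xs)"
      using len_eq by simp
    have "len (cls t (us @ vs)) = length us + len (cls t vs)" "left_ascent t s (us @ vs)"
      using ascent left_ascent_cong[OF xs_eq] len_eq xs_eq by auto
    then obtain k where "k < cox_m t s r" "cls t (us @ vs) = cls t (alt r s k @ vs)"
      by (rule alternating_prefix_if_left_ascent[OF s r us vs])
    moreover have "0 < orbit t vs s" "0 < orbit t vs r"
      using less.hyps[OF shorter _ vs] s r minimal by auto
    ultimately show ?thesis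
      using act_word_alt_pos[OF s r \<open>s \<noteq> r\<close>, of "orbit t vs" k t] orbit_cong[OF xs_eq]
        orbit_cong[of t "us @ vs"]
      by (simp add: orbit_append)
  qed
qed

lemma left_ascent_iff_orbit_pos:
  assumes "s \<in> Gens" "set xs \<subseteq> Gens"
  shows "left_ascent t s xs \<longleftrightarrow> 0 < orbit t xs s"
proof
  assume "0 < orbit t xs s"
  then have "\<not> 0 < orbit t (s # xs) s"
    by (simp add: orbit_Cons act_self)
  then have "\<not> left_ascent t s (s # xs)"
    using orbit_pos_if_left_ascent[of s "s # xs" t] assms by auto
  then show "left_ascent t s xs"
    by (simp add: left_ascent_Cons_iff[OF assms])
qed (rule orbit_pos_if_left_ascent[OF assms])

lemma left_ascent_exists:
  assumes "set xs \<subseteq> Gens"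
  obtains s where "s \<in> Gens" "left_ascent t s xs"
proof -
  define d :: int where "d = (if t = TA2 then 1 else 2)"
  \<comment> \<open>the imaginary root, which all reflections fix\<close>
  define \<delta> where "\<delta> v = d * v 1 + v 2 + v 3" for v :: "nat \<Rightarrow> int"
  have "\<delta> (act t s v) = \<delta> v" for s v
    by (cases "s \<in> Gens"; cases t)
      (auto simp: \<delta>_def d_def act_def coef_def Gens_def algebra_simps)
  then have "\<delta> (orbit t xs) = \<delta> (\<lambda>_. 1)"
    by (induction xs) (auto simp: orbit_Cons)
  moreover have "0 < \<delta> (\<lambda>_. 1)" "0 < d"
    by (auto simp: \<delta>_def d_def)
  ultimately have "\<exists>s\<in>Gens. 0 < orbit t xs s"
    unfolding \<delta>_def Gens_def by (smt (verit) insertCI mult_nonneg_nonpos)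
  then show ?thesis
    using that left_ascent_iff_orbit_pos[OF _ assms, of _ t] by blast
qed

section \<open>Parabolic cosets\<close>

lemma left_ascent_Nil: "s \<in> Gens \<Longrightarrow> left_ascent t s []"
  by (simp add: left_ascent_iff_orbit_pos)

lemma len_alt_append:
  assumes "s \<in> Gens" "r \<in> Gens" "set vs \<subseteq> Gens" "left_ascent t s vs" "left_ascent t r vs"
    and "k \<le> cox_m t s r"
  shows "len (cls t (alt s r k @ vs)) = k + len (cls t vs)"
  using assms
proof (induction k arbitrary: s r)
  case (Suc k)
  note s = Suc.prems(1) and r = Suc.prems(2) and vs = Suc.prems(3)
  have "0 < orbit t (alt r s k @ vs) s"
  proof (cases "s = r")
    case True
    then show ?thesis
      using Suc.prems by (simp add: cox_m_def orbit_append left_ascent_iff_orbit_pos)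
  next
    case False
    then show ?thesis
      using Suc.prems act_word_alt_pos[OF s r False, of "orbit t vs" k t]
      by (simp add: orbit_append left_ascent_iff_orbit_pos)
  qed
  then have "left_ascent t s (alt r s k @ vs)"
    using s vs set_alt_subset_Gens[OF r s] by (simp add: left_ascent_iff_orbit_pos)
  then have "len (cls t (alt s r (Suc k) @ vs)) = Suc (len (cls t (alt r s k @ vs)))"
    using s vs set_alt_subset_Gens[OF r s] by (simp add: len_Cons_if_left_ascent)
  also have "\<dots> = Suc k + len (cls t vs)"
    using Suc by (simp add: cox_m_sym[of t r s])
  finally show ?case .
qed simp

lemma len_alt:
  assumes "s \<in> Gens" "r \<in> Gens" "k \<le> cox_m t s r"
  shows "len (cls t (alt s r k)) = k"
  using len_alt_append[of s r "[]" t k] assms by (simp add: left_ascent_Nil)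

lemma len_singleton: "s \<in> Gens \<Longrightarrow> len (cls t [s]) = 1"
  using len_alt[of s s 1 t] by (simp add: cox_m_def)

lemma len_parabolic_append:
  assumes "s \<in> Gens" "r \<in> Gens" "set us \<subseteq> {s, r}" "set vs \<subseteq> Gens"
    and "left_ascent t s vs" "left_ascent t r vs"
  shows "len (cls t (us @ vs)) = len (cls t us) + len (cls t vs)"
proof -
  obtain a b k where ab: "{a, b} = {s, r}" and k: "k \<le> cox_m t s r"
      and us_eq: "cls t us = cls t (alt a b k)"
    by (rule cls_eq_alt[OF assms(1-3)])
  then have "len (cls t (alt a b k @ vs)) = k + len (cls t vs)" "len (cls t (alt a b k)) = k"
    using assms by (auto simp: doubleton_eq_iff cox_m_sym intro!: len_alt_append len_alt)
  then show ?thesis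
    using cls_append_cong[OF us_eq HOL.refl, of vs] us_eq by simp
qed

lemma coset_decomposition_unique:
  assumes "s \<in> Gens" "r \<in> Gens"
    and us: "set us \<subseteq> {s, r}" "set us' \<subseteq> {s, r}"
    and vs: "set vs \<subseteq> Gens" "left_ascent t s vs" "left_ascent t r vs"
    and vs': "set vs' \<subseteq> Gens" "left_ascent t s vs'" "left_ascent t r vs'"
    and eq: "cls t (us @ vs) = cls t (us' @ vs')"
  shows "cls t us = cls t us' \<and> cls t vs = cls t vs'"
proof -
  have Gens: "set us \<subseteq> Gens" "set us' \<subseteq> Gens"
    using us assms(1,2) by auto
  have vs'_eq: "cls t vs' = cls t ((rev us' @ us) @ vs)"
    using cls_append_cong[OF HOL.refl eq, of "rev us'"] cls_rev_append[OF Gens(2)] by simp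
  have vs_eq: "cls t vs = cls t ((rev us @ us') @ vs')"
    using cls_append_cong[OF HOL.refl eq, of "rev us"] cls_rev_append[OF Gens(1)] by simp
  have "len (cls t vs') = len (cls t (rev us' @ us)) + len (cls t vs)"
    unfolding vs'_eq by (rule len_parabolic_append[OF assms(1,2)]) (use us vs in auto)
  moreover have "len (cls t vs) = len (cls t (rev us @ us')) + len (cls t vs')"
    unfolding vs_eq by (rule len_parabolic_append[OF assms(1,2)]) (use us vs' in auto)
  ultimately have "len (cls t (rev us' @ us)) = 0" by simp
  then have triv: "cls t (rev us' @ us) = cls t []"
    using len_eq_0_iff[of "rev us' @ us" t] Gens by simp
  have "cls t vs = cls t vs'"
    using cls_append_cong[OF triv HOL.refl, of vs] vs'_eq by simp
  moreover have "cls t us = cls t us'"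
    using cls_append_cong[OF HOL.refl triv, of us'] cls_rev_append[of "rev us'" t us] Gens by simp
  ultimately show ?thesis by simp
qed

section \<open>Straight elements\<close>

definition word_power :: "nat list \<Rightarrow> nat \<Rightarrow> nat list" where
  "word_power xs k = concat (replicate k xs)"

lemma word_power_0 [simp]: "word_power xs 0 = []"
  by (simp add: word_power_def)

lemma word_power_Suc [simp]: "word_power xs (Suc k) = xs @ word_power xs k"
  by (simp add: word_power_def)

lemma set_word_power_subset: "set (word_power xs k) \<subseteq> set xs"
  by (auto simp: word_power_def)

definition straight :: "afftype \<Rightarrow> nat list \<Rightarrow> bool" where
  "straight t xs \<longleftrightarrow> (\<forall>k. len (cls t (word_power xs k)) = k * length xs)"

fun positive_word :: "afftype \<Rightarrow> nat list \<Rightarrow> (nat \<Rightarrow> int) \<Rightarrow> bool" where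
  "positive_word t [] v \<longleftrightarrow> True"
| "positive_word t (s # xs) v \<longleftrightarrow> positive_word t xs v \<and> 0 < act_word t xs v s"

lemma len_append_if_positive_word:
  assumes "set xs \<subseteq> Gens" "set ys \<subseteq> Gens" "positive_word t xs (orbit t ys)"
  shows "len (cls t (xs @ ys)) = length xs + len (cls t ys)"
  using assms
  by (induction xs) (auto simp: len_Cons_if_left_ascent left_ascent_iff_orbit_pos orbit_append)

lemma straight_if_invariant_cone:
  assumes "set xs \<subseteq> Gens" "C (\<lambda>_. 1)"
    and cone: "\<And>v. C v \<Longrightarrow> positive_word t xs v \<and> C (act_word t xs v)"
  shows "straight t xs"
proof -
  have "C (orbit t (word_power xs k)) \<and> len (cls t (word_power xs k)) = k * length xs" for k
  proof (induction k)
    case (Suc k)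
    have "set (word_power xs k) \<subseteq> Gens"
      using assms(1) set_word_power_subset[of xs k] by blast
    then show ?case
      using Suc cone[of "orbit t (word_power xs k)"] len_append_if_positive_word[OF assms(1)]
      by (simp add: orbit_append)
  qed (simp add: assms(2))
  then show ?thesis by (simp add: straight_def)
qed

lemma set_wword: "set (wword t i) \<subseteq> Gens"
  by (cases t) (auto simp: wword_def Gens_def)

text \<open>The last inequality of each cone says that the affine invariant is positive; the others are
  the orbit of the positivity conditions of one period, up to multiples of that invariant.\<close>

definition wword_cone :: "afftype \<Rightarrow> nat \<Rightarrow> (nat \<Rightarrow> int) \<Rightarrow> bool" where
  "wword_cone t i v \<longleftrightarrow> (case t of
       TA2 \<Rightarrow> 0 < v (if i = 1 then 1 else 2) \<and> 0 < v 1 + v 2 \<and> 0 < v 1 + v 2 + v 3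
     | TC2 \<Rightarrow> (if i = 1 then 0 < v 1 else 0 < v 2 \<and> 0 < 2 * v 1 + v 2)
         \<and> 0 < v 1 + v 2 \<and> 0 < 2 * v 1 + v 2 + v 3
     | TG2 \<Rightarrow> 0 < (if i = 1 then v 1 + v 2 + v 3 else 3 * v 1 + v 2)
         \<and> 0 < v 2 \<and> 0 < v 1 + v 2 \<and> 0 < 3 * v 1 + 2 * v 2 \<and> 0 < 2 * v 1 + v 2
         \<and> 0 < 2 * v 1 + v 2 + v 3)"

lemma straight_wword: "straight t (wword t i)"
proof (rule straight_if_invariant_cone[OF set_wword])
  show "wword_cone t i (\<lambda>_. 1)"
    by (cases t) (simp_all add: wword_cone_def)
  show "positive_word t (wword t i) v \<and> wword_cone t i (act_word t (wword t i) v)"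
    if "wword_cone t i v" for v
    using that
    by (cases t; cases "i = 1") (auto simp: wword_cone_def wword_def act_def coef_def Gens_def)
qed

section \<open>Inverses in noncommutative rings\<close>

definition invertible :: "'a::monoid_mult \<Rightarrow> bool" where
  "invertible a \<longleftrightarrow> (\<exists>b. a * b = 1 \<and> b * a = 1)"

definition uinv :: "'a::monoid_mult \<Rightarrow> 'a" where
  "uinv a = (THE b. a * b = 1 \<and> b * a = 1)"

lemma left_inverse_eq_right_inverse:
  fixes a b c :: "'a::monoid_mult"
  assumes "b * a = 1" "a * c = 1"
  shows "b = c"
  by (metis assms mult.assoc mult_1_left mult_1_right)

lemma uinv_eqI:
  assumes "a * b = 1" "b * a = 1"
  shows "uinv a = b"
  unfolding uinv_def using assms left_inverse_eq_right_inverse by blast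

lemma mult_uinv:
  assumes "invertible a"
  shows "a * uinv a = 1" "uinv a * a = 1"
  using assms uinv_eqI unfolding invertible_def by auto

lemma mult_uinv_cancel:
  assumes "invertible a"
  shows "a * (uinv a * b) = b" "uinv a * (a * b) = b"
  using mult_uinv[OF assms] by (simp_all flip: mult.assoc)

lemmas uinv_simps = mult_uinv mult_uinv_cancel

lemma uinv_eq_iff_left:
  assumes "invertible a"
  shows "uinv a * b = c \<longleftrightarrow> b = a * c"
  using assms by (auto simp: uinv_simps)

lemma uinv_eq_iff_right:
  assumes "invertible a"
  shows "b * uinv a = c \<longleftrightarrow> b = c * a"
  using assms by (auto simp: uinv_simps mult.assoc)

lemma invertible_uinv: "invertible a \<Longrightarrow> invertible (uinv a)"
  unfolding invertible_def using mult_uinv invertible_def by metis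

lemma uinv_uinv: "invertible a \<Longrightarrow> uinv (uinv a) = a"
  by (rule uinv_eqI) (simp_all add: mult_uinv)

lemma invertible_mult:
  assumes "invertible a" "invertible b"
  shows "invertible (a * b)" and uinv_mult: "uinv (a * b) = uinv b * uinv a"
proof -
  have "(a * b) * (uinv b * uinv a) = 1" "(uinv b * uinv a) * (a * b) = 1"
    using assms by (simp_all add: mult.assoc uinv_simps)
  then show "invertible (a * b)" "uinv (a * b) = uinv b * uinv a"
    by (auto simp: invertible_def intro: uinv_eqI)
qed

lemma right_inverse_eq_product:
  assumes "invertible b" "invertible n" "a * c * b = n" "c * w = 1"
  shows "w = b * uinv n * a"
proof -
  have "n * (uinv b * w) = a * (c * w)"
    unfolding assms(3)[symmetric] by (simp add: mult.assoc uinv_simps assms(1))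
  then have "n * (uinv b * w) = a"
    by (simp add: assms(4))
  then have "uinv b * w = uinv n * a"
    using uinv_eq_iff_left[OF assms(2)] by metis
  then show ?thesis
    using uinv_eq_iff_left[OF assms(1)] by (simp add: mult.assoc)
qed

section \<open>Dihedral sums\<close>

primrec alt_prod :: "'a::monoid_mult \<Rightarrow> 'a \<Rightarrow> nat \<Rightarrow> 'a" where
  "alt_prod x y 0 = 1"
| "alt_prod x y (Suc k) = x * alt_prod y x k"

primrec alt_prod_rev :: "'a::monoid_mult \<Rightarrow> 'a \<Rightarrow> nat \<Rightarrow> 'a" where
  "alt_prod_rev x y 0 = 1"
| "alt_prod_rev x y (Suc k) = alt_prod_rev y x k * x"

definition alt_sum :: "nat \<Rightarrow> 'a::{ring,monoid_mult} \<Rightarrow> 'a \<Rightarrow> 'a" where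
  "alt_sum m x y = (\<Sum>k<m. alt_prod x y k)"

definition alt_sum_rev :: "nat \<Rightarrow> 'a::{ring,monoid_mult} \<Rightarrow> 'a \<Rightarrow> 'a" where
  "alt_sum_rev m x y = (\<Sum>k<m. alt_prod_rev x y k)"

definition dihedral_sum :: "nat \<Rightarrow> 'a::{ring,monoid_mult} \<Rightarrow> 'a \<Rightarrow> 'a" where
  "dihedral_sum m x y = (\<Sum>k\<le>m. alt_prod x y k) + (\<Sum>k=1..<m. alt_prod y x k)"

lemma alt_prod_numeral:
  "alt_prod x y 2 = x*y"
  "alt_prod x y 3 = x*y*x"
  "alt_prod x y 4 = x*y*x*y"
  by (simp_all add: eval_nat_numeral mult.assoc)

lemma alt_sum_numeral:
  "alt_sum 3 x y = 1 + x + x*y"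
  "alt_sum 4 x y = 1 + x + x*y + x*y*x"
  by (simp_all add: alt_sum_def eval_nat_numeral mult.assoc)

lemma alt_sum_rev_numeral:
  "alt_sum_rev 3 x y = 1 + x + y*x"
  "alt_sum_rev 6 x y = 1 + x + y*x + x*y*x + y*x*y*x + x*y*x*y*x"
  by (simp_all add: alt_sum_rev_def eval_nat_numeral mult.assoc)

lemma dihedral_sum_numeral:
  "dihedral_sum 2 x y = 1 + x + y + x*y"
  "dihedral_sum 3 x y = 1 + x + y + x*y + y*x + x*y*x"
  "dihedral_sum 4 x y = 1 + x + y + x*y + y*x + x*y*x + y*x*y + x*y*x*y"
  by (simp_all add: dihedral_sum_def eval_nat_numeral algebra_simps)

lemma alt_prod_Suc_right: "alt_prod x y (Suc k) = alt_prod x y k * (if even k then x else y)"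
proof (induction k arbitrary: x y)
  case (Suc k)
  have "alt_prod x y (Suc (Suc k)) = x * (alt_prod y x k * (if even k then y else x))"
    unfolding Suc[symmetric] by simp
  then show ?case by (simp add: mult.assoc)
qed simp

lemma alt_prod_rev_eq: "alt_prod_rev x y k = (if even k then alt_prod y x k else alt_prod x y k)"
proof (induction k arbitrary: x y)
  case (Suc k)
  then show ?case
    using alt_prod_Suc_right[of x y k] alt_prod_Suc_right[of y x k]
    by (simp del: alt_prod.simps(2))
qed simp

lemma sum_lessThan_eq_zeroth_plus:
  fixes f :: "nat \<Rightarrow> 'a::comm_monoid_add"
  assumes "0 < m"
  shows "(\<Sum>k<m. f k) = f 0 + (\<Sum>k=1..<m. f k)"
  using assms sum.atLeast_Suc_lessThan[of 0 m f] by (simp add: lessThan_atLeast0)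

lemma dihedral_sum_eq:
  assumes "0 < m"
  shows "dihedral_sum m x y = 1 + (\<Sum>k=1..<m. alt_prod x y k + alt_prod y x k) + alt_prod x y m"
  using sum_lessThan_eq_zeroth_plus[OF assms, of "alt_prod x y"]
  by (simp add: dihedral_sum_def sum.distrib add_ac flip: lessThan_Suc_atMost)

lemma dihedral_sum_commute:
  assumes "0 < m" "alt_prod x y m = alt_prod y x m"
  shows "dihedral_sum m x y = dihedral_sum m y x"
  using assms by (simp add: dihedral_sum_eq add.commute)

lemma one_plus_mult_alt_sum:
  assumes "0 < m"
  shows "(1 + x) * alt_sum m y x = dihedral_sum m x y"
proof -
  have "x * alt_sum m y x = (\<Sum>k=1..<Suc m. alt_prod x y k)"
    by (simp add: alt_sum_def sum_distrib_left sum.atLeast1_atMost_eq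
        atLeastLessThanSuc_atLeastAtMost)
  also have "\<dots> = (\<Sum>k=1..<m. alt_prod x y k) + alt_prod x y m"
    using assms by simp
  finally have "x * alt_sum m y x = \<dots>" .
  moreover have "alt_sum m y x = 1 + (\<Sum>k=1..<m. alt_prod y x k)"
    by (simp add: alt_sum_def sum_lessThan_eq_zeroth_plus[OF assms])
  ultimately show ?thesis
    by (simp add: dihedral_sum_eq[OF assms] sum.distrib distrib_right add_ac)
qed

lemma alt_sum_rev_mult_one_plus:
  assumes "0 < m" "alt_prod x y m = alt_prod y x m"
  shows "alt_sum_rev m y x * (1 + x) = dihedral_sum m x y"
proof -
  have "alt_sum_rev m y x * x = (\<Sum>k=1..<Suc m. alt_prod_rev x y k)"
    by (simp add: alt_sum_rev_def sum_distrib_right sum.atLeast1_atMost_eq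
        atLeastLessThanSuc_atLeastAtMost)
  also have "\<dots> = (\<Sum>k=1..<m. alt_prod_rev x y k) + alt_prod_rev x y m"
    using assms by simp
  finally have "alt_sum_rev m y x * x = \<dots>" .
  moreover have "alt_sum_rev m y x = 1 + (\<Sum>k=1..<m. alt_prod_rev y x k)"
    by (simp add: alt_sum_rev_def sum_lessThan_eq_zeroth_plus[OF assms(1)])
  ultimately have "alt_sum_rev m y x * (1 + x)
      = 1 + (\<Sum>k=1..<m. alt_prod_rev x y k + alt_prod_rev y x k) + alt_prod_rev x y m"
    by (simp add: sum.distrib distrib_left add_ac)
  moreover have "alt_prod_rev x y k + alt_prod_rev y x k = alt_prod x y k + alt_prod y x k" for k
    by (simp add: alt_prod_rev_eq add.commute)
  moreover have "alt_prod_rev x y m = alt_prod x y m"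
    using assms(2) by (simp add: alt_prod_rev_eq)
  ultimately show ?thesis
    by (simp add: dihedral_sum_eq[OF assms(1)])
qed

section \<open>The triangle identities\<close>

locale triangle_ring =
  fixes x y z :: "'a::{ring,monoid_mult}" and m12 m13 m23 :: nat
  assumes invertible: "invertible (1 + x)" "invertible (1 + y)" "invertible (1 + z)"
      "invertible (dihedral_sum m12 x y)" "invertible (dihedral_sum m13 x z)"
      "invertible (dihedral_sum m23 y z)"
    and braid: "alt_prod x y m12 = alt_prod y x m12" "alt_prod x z m13 = alt_prod z x m13"
      "alt_prod y z m23 = alt_prod z y m23"
    and pos: "0 < m12" "0 < m13" "0 < m23"
begin

abbreviation w12 :: 'a where "w12 \<equiv> dihedral_sum m12 x y"
abbreviation w13 :: 'a where "w13 \<equiv> dihedral_sum m13 x z"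
abbreviation w23 :: 'a where "w23 \<equiv> dihedral_sum m23 y z"
abbreviation ix :: 'a where "ix \<equiv> uinv (1 + x)"
abbreviation iy :: 'a where "iy \<equiv> uinv (1 + y)"
abbreviation iz :: 'a where "iz \<equiv> uinv (1 + z)"

definition alternating_inverse_sum :: 'a where
  "alternating_inverse_sum = 1 - ix - iy - iz + uinv w12 + uinv w13 + uinv w23"

lemmas inverse_simps = invertible[THEN mult_uinv(1)] invertible[THEN mult_uinv(2)]
  invertible[THEN mult_uinv_cancel(1)] invertible[THEN mult_uinv_cancel(2)]

lemma left_quotient:
  "ix * w12 = alt_sum m12 y x" "iy * w12 = alt_sum m12 x y"
  "ix * w13 = alt_sum m13 z x" "iz * w13 = alt_sum m13 x z"
  "iy * w23 = alt_sum m23 z y"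
  using dihedral_sum_commute[OF pos(1) braid(1)] dihedral_sum_commute[OF pos(2) braid(2)]
  by (simp_all add: uinv_eq_iff_left invertible one_plus_mult_alt_sum pos)

lemma right_quotient:
  "w12 * ix = alt_sum_rev m12 y x"
  "w13 * ix = alt_sum_rev m13 z x" "w13 * iz = alt_sum_rev m13 x z"
  using dihedral_sum_commute[OF pos(2) braid(2)] braid
  by (simp_all add: uinv_eq_iff_right invertible alt_sum_rev_mult_one_plus pos)

lemma
  assumes "m23 = 2"
  shows w23_mult_iy_iz: "w23 * iy * iz = 1" and uinv_w23: "uinv w23 = iz * iy"
proof -
  have factor: "w23 = (1 + y) * (1 + z)" "w23 = (1 + z) * (1 + y)"
    using braid(3) by (simp_all add: assms dihedral_sum_numeral alt_prod_numeral algebra_simps)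
  show "w23 * iy * iz = 1"
    unfolding factor(2) by (simp add: mult.assoc inverse_simps)
  show "uinv w23 = iz * iy"
    unfolding factor(1) by (rule uinv_mult) (rule invertible)+
qed

lemma alternating_inverse_sum_factors_442:
  assumes orders: "m12 = 4" "m13 = 4" "m23 = 2"
  shows "(ix * w13) * alternating_inverse_sum * w12 = (1 - z*x*y) * (1 - z*x*y*x)"
proof -
  define Z where "Z = 1 + z + z*x + z*x*z"
  define U where "U = 1 + y + y*x + y*x*y"
  define V where "V = 1 + x + x*y + x*y*x"
  have w12: "w12 = 1 + x + y + x*y + y*x + x*y*x + y*x*y + x*y*x*y"
    and quotients: "ix * w13 = Z" "ix * w12 = U" "iy * w12 = V"
    using left_quotient by (simp_all add: orders dihedral_sum_numeral alt_sum_numeral Z_def U_def V_def)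
  have relations: "x*y*x*y = y*x*y*x" "y*z = z*y"
    using braid by (simp_all add: orders alt_prod_numeral)
  have Z_iz: "Z * iz = 1 + z*x"
    unfolding uinv_eq_iff_right[OF invertible(3)] Z_def by (simp add: algebra_simps)
  have Z_inv: "Z * uinv w13 = ix"
    unfolding quotients(1)[symmetric] by (simp add: mult.assoc inverse_simps)
  have "Z * alternating_inverse_sum * w12
      = Z * w12 - Z * (ix * w12) - Z * (iy * w12) - (Z * iz) * w12 + Z * (uinv w12 * w12)
        + (Z * uinv w13) * w12 + (Z * iz) * (iy * w12)"
    unfolding alternating_inverse_sum_def by (simp add: uinv_w23[OF orders(3)] algebra_simps)
  also have "\<dots> = Z * w12 - Z * U - Z * V - (1 + z*x) * w12 + Z + U + (1 + z*x) * V"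
    by (simp add: quotients Z_iz Z_inv inverse_simps)
  also have "\<dots> = 1 - z*x*y - z*x*y*x + z*x*z*(x*y*x*y)"
    unfolding w12 Z_def U_def V_def by (simp add: algebra_simps)
  also have "z*x*z*(x*y*x*y) = z*x*(y*z)*x*y*x"
    unfolding relations by (simp add: mult.assoc)
  also have "1 - z*x*y - z*x*y*x + z*x*(y*z)*x*y*x = (1 - z*x*y) * (1 - z*x*y*x)"
    by (simp add: algebra_simps)
  finally show ?thesis unfolding quotients .
qed

lemma alternating_inverse_sum_factors_632:
  assumes orders: "m12 = 6" "m13 = 3" "m23 = 2"
  shows "w13 * alternating_inverse_sum * (w12 * ix) = (1 - z*x*y) * (1 - z*x*y*x*y)"
proof -
  define X where "X = 1 + y + x*y + y*x*y + x*y*x*y + y*x*y*x*y"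
  define V where "V = 1 + x*y + x*y*x*y"
  define Y where "Y = 1 + x + z*x"
  define Y' where "Y' = 1 + z + x*z"
  have w13: "w13 = 1 + x + z + x*z + z*x + x*z*x"
    and quotients: "w12 * ix = X" "w13 * iz = Y" "w13 * ix = Y'"
    using right_quotient
    by (simp_all add: orders dihedral_sum_numeral alt_sum_rev_numeral X_def Y_def Y'_def)
  have relations: "x*z*x = z*x*z" "y*z = z*y"
    using braid(2,3) by (simp_all add: orders alt_prod_numeral)
  have iy_X: "iy * X = V"
    unfolding uinv_eq_iff_left[OF invertible(2)] X_def V_def by (simp add: algebra_simps)
  have inv_X: "uinv w12 * X = ix"
    unfolding quotients(1)[symmetric] by (simp add: inverse_simps)
  have "w13 * alternating_inverse_sum * X
      = w13 * X - (w13 * ix) * X - w13 * (iy * X) - (w13 * iz) * X + w13 * (uinv w12 * X)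
        + (w13 * uinv w13) * X + (w13 * iz) * (iy * X)"
    unfolding alternating_inverse_sum_def by (simp add: uinv_w23[OF orders(3)] algebra_simps)
  also have "\<dots> = w13 * X - Y' * X - w13 * V - Y * X + Y' + X + Y * V"
    by (simp add: quotients iy_X inv_X inverse_simps)
  also have "\<dots> = x*z*x*X + Y' - (z + x*z + x*z*x) * V"
    unfolding w13 Y_def Y'_def by (simp add: algebra_simps)
  also have "\<dots> = 1 - z*x*y - z*x*y*x*y + (x*z*x)*y*x*y*x*y"
    unfolding X_def Y'_def V_def by (simp add: algebra_simps)
  also have "(x*z*x)*y*x*y*x*y = z*x*(y*z)*x*y*x*y"
    unfolding relations by (simp add: mult.assoc)
  also have "1 - z*x*y - z*x*y*x*y + z*x*(y*z)*x*y*x*y = (1 - z*x*y) * (1 - z*x*y*x*y)"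
    by (simp add: algebra_simps)
  finally show ?thesis unfolding quotients .
qed

lemma partial_quotients:
  "ix * (1 + y + x*y) = ix + y"
  "(1 + z + z*y) * iy = iy + z"
  "(1 + z + z*y) * iz = 1 + z*y*iz"
proof -
  have "(1 + x) * (ix + y) = 1 + y + x*y"
    unfolding distrib_left inverse_simps by (simp add: algebra_simps)
  then show "ix * (1 + y + x*y) = ix + y"
    by (simp only: uinv_eq_iff_left invertible)
  have "(iy + z) * (1 + y) = 1 + z + z*y"
    unfolding distrib_right inverse_simps by (simp add: algebra_simps)
  then show "(1 + z + z*y) * iy = iy + z"
    by (simp only: uinv_eq_iff_right invertible)
  have "(1 + z*y*iz) * (1 + z) = 1 + z + z*y"
    unfolding distrib_right mult.assoc inverse_simps by simp
  then show "(1 + z + z*y) * iz = 1 + z*y*iz"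
    by (simp only: uinv_eq_iff_right invertible)
qed

lemma uinv_w13_mult_333:
  assumes orders: "m12 = 3" "m13 = 3"
  shows "uinv w13 * (w12 * ix) = uinv w13 * (1 - z*x*y) + iz * y"
    and "x * (1 + z) * uinv w13 = iz - uinv w13"
proof -
  have "uinv w13 * (1 + x + z*x) = uinv w13 * (w13 * iz)"
    using right_quotient(3) by (simp add: orders alt_sum_rev_numeral)
  then have "uinv w13 * (1 + x + z*x) = iz"
    by (simp add: inverse_simps)
  moreover have "w12 * ix = (1 + x + z*x) * y + (1 - z*x*y)"
    using right_quotient(1) by (simp add: orders alt_sum_rev_numeral algebra_simps)
  ultimately show "uinv w13 * (w12 * ix) = uinv w13 * (1 - z*x*y) + iz * y"
    by (simp add: distrib_left add.commute flip: mult.assoc)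
  have "(1 + x + x*z) * uinv w13 = iz * w13 * uinv w13"
    using left_quotient(4) by (simp add: orders alt_sum_numeral)
  then show "x * (1 + z) * uinv w13 = iz - uinv w13"
    by (simp add: mult.assoc inverse_simps) (simp add: algebra_simps)
qed

lemma alternating_inverse_sum_factors_333:
  assumes orders: "m12 = 3" "m13 = 3" "m23 = 3"
  shows "(iy * w23) * alternating_inverse_sum * (w12 * ix)
    = (1 - z*y*x) * (1 + z) * uinv w13 * (1 - z*x*y)"
proof -
  define X where "X = 1 + y + x*y"
  define Z where "Z = 1 + z + z*y"
  define J where "J = uinv w13"
  have quotients: "w12 * ix = X" "iy * w23 = Z"
    using left_quotient right_quotient
    by (simp_all add: orders alt_sum_numeral alt_sum_rev_numeral X_def Z_def)
  have inv_X: "uinv w12 * X = ix" and Z_inv: "Z * uinv w23 = iy"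
    unfolding quotients[symmetric] by (simp_all add: mult.assoc inverse_simps)
  have partial: "ix * X = ix + y" "Z * iy = iy + z" "Z * iz = 1 + z*y*iz"
    unfolding X_def Z_def by (rule partial_quotients)+
  have J_X: "J * X = J * (1 - z*x*y) + iz * y" and x_J: "x * (1 + z) * J = iz - J"
    using uinv_w13_mult_333[OF orders(1,2)] by (simp_all add: J_def quotients)
  have iz_z: "1 - iz = iz * z"
    using mult_uinv(2)[OF invertible(3)] by (simp add: algebra_simps)
  have "Z * alternating_inverse_sum * X
      = Z * X - Z * (ix * X) - (Z * iy) * X - (Z * iz) * X + Z * (uinv w12 * X)
        + Z * (J * X) + (Z * uinv w23) * X"
    unfolding alternating_inverse_sum_def J_def by (simp add: algebra_simps)
  also have "\<dots> = z*y*X - Z*y - z*y*iz*X + Z * (J * X)"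
    unfolding partial inv_X Z_inv by (simp add: Z_def algebra_simps)
  also have "Z * (J * X) = Z * J * (1 - z*x*y) + (Z * iz) * y"
    unfolding J_X by (simp add: algebra_simps)
  also have "z*y*X - Z*y - z*y*iz*X + (Z * J * (1 - z*x*y) + (Z * iz) * y)
      = Z * J * (1 - z*x*y) - z*y*iz + z*y*(1 - iz)*x*y"
    unfolding partial(3) by (simp add: X_def Z_def algebra_simps)
  also have "\<dots> = ((1 + z) * J - z*y*(iz - J)) * (1 - z*x*y)"
    unfolding iz_z by (simp add: Z_def algebra_simps)
  also have "\<dots> = (1 - z*y*x) * (1 + z) * J * (1 - z*x*y)"
    unfolding x_J[symmetric] by (simp add: algebra_simps)
  finally show ?thesis unfolding quotients J_def .
qed

lemma right_inverse_eq_product_442: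
  assumes orders: "m12 = 4" "m13 = 4" "m23 = 2" and w: "alternating_inverse_sum * w = 1"
    and inv: "invertible (1 - z*x*y*x)" "invertible (1 - z*x*y)"
  shows "w = w12 * uinv (1 - z*x*y*x) * uinv (1 - z*x*y) * ix * w13 * w23 * iy * iz"
proof -
  have "w = w12 * uinv ((1 - z*x*y) * (1 - z*x*y*x)) * (ix * w13)"
    by (rule right_inverse_eq_product[OF invertible(4) _ alternating_inverse_sum_factors_442[OF orders] w])
      (simp add: invertible_mult inv)
  also have "\<dots> = w12 * uinv (1 - z*x*y*x) * uinv (1 - z*x*y) * ix * w13 * (w23 * iy * iz)"
    unfolding uinv_mult[OF inv(2,1)] w23_mult_iy_iz[OF orders(3)] by (simp add: mult.assoc)
  finally show ?thesis by (simp add: mult.assoc)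
qed

lemma right_inverse_eq_product_632:
  assumes orders: "m12 = 6" "m13 = 3" "m23 = 2" and w: "alternating_inverse_sum * w = 1"
    and inv: "invertible (1 - z*x*y)" "invertible (1 - z*x*y*x*y)"
  shows "w = w12 * ix * uinv (1 - z*x*y*x*y) * uinv (1 - z*x*y) * w13 * w23 * iy * iz"
proof -
  have "w = (w12 * ix) * uinv ((1 - z*x*y) * (1 - z*x*y*x*y)) * w13"
    by (rule right_inverse_eq_product[OF _ _ alternating_inverse_sum_factors_632[OF orders] w])
      (simp_all add: invertible_mult invertible_uinv invertible inv)
  also have "\<dots> = w12 * ix * uinv (1 - z*x*y*x*y) * uinv (1 - z*x*y) * w13 * (w23 * iy * iz)"
    unfolding uinv_mult[OF inv] w23_mult_iy_iz[OF orders(3)] by (simp add: mult.assoc)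
  finally show ?thesis by (simp add: mult.assoc)
qed

lemma right_inverse_eq_product_333:
  assumes orders: "m12 = 3" "m13 = 3" "m23 = 3" and w: "alternating_inverse_sum * w = 1"
    and inv: "invertible (1 - z*y*x)" "invertible (1 - z*x*y)"
  shows "w = w12 * ix * uinv (1 - z*x*y) * w13 * iz * uinv (1 - z*y*x) * iy * w23"
proof -
  have "w = (w12 * ix) * uinv ((1 - z*y*x) * (1 + z) * uinv w13 * (1 - z*x*y)) * (iy * w23)"
    by (rule right_inverse_eq_product[OF _ _ alternating_inverse_sum_factors_333[OF orders] w])
      (simp_all add: invertible_mult invertible_uinv invertible inv)
  also have "uinv ((1 - z*y*x) * (1 + z) * uinv w13 * (1 - z*x*y))
      = uinv (1 - z*x*y) * (w13 * (iz * uinv (1 - z*y*x)))"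
    by (simp add: uinv_mult uinv_uinv invertible_mult invertible_uinv invertible inv)
  finally show ?thesis by (simp add: mult.assoc)
qed

end

section \<open>Products of group elements\<close>

definition wmul :: "afftype \<Rightarrow> nat list set \<Rightarrow> nat list set \<Rightarrow> nat list set" where
  "wmul t v w = (\<Union>xs\<in>v. \<Union>ys\<in>w. cls t (xs @ ys))"

lemma wmul_cls: "wmul t (cls t xs) (cls t ys) = cls t (xs @ ys)"
proof -
  have "cls t zs' = cls t zs" if "zs' \<in> cls t zs" for zs zs'
    using that unfolding cls_eq_iff by (auto simp: cls_def intro: cox_eqv.sym)
  then have "cls t (xs' @ ys') = cls t (xs @ ys)" if "xs' \<in> cls t xs" "ys' \<in> cls t ys" for xs' ys'
    using that by (intro cls_append_cong)
  moreover have "xs \<in> cls t xs" "ys \<in> cls t ys"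
    by (simp_all add: cls_def cox_eqv.refl)
  ultimately show ?thesis
    unfolding wmul_def by blast
qed

lemma Wgrp_iff: "w \<in> Wgrp t \<longleftrightarrow> (\<exists>xs. set xs \<subseteq> Gens \<and> w = cls t xs)"
  by (auto simp: Wgrp_def Wsub_def)

lemma cls_in_Wgrp: "set xs \<subseteq> Gens \<Longrightarrow> cls t xs \<in> Wgrp t"
  unfolding Wgrp_iff by blast

lemma wmul_in_Wgrp:
  assumes "v \<in> Wgrp t" "w \<in> Wgrp t"
  shows "wmul t v w \<in> Wgrp t"
proof -
  obtain xs ys where "set xs \<subseteq> Gens" "v = cls t xs" "set ys \<subseteq> Gens" "w = cls t ys"
    using assms unfolding Wgrp_iff by blast
  then show ?thesis by (simp add: wmul_cls cls_in_Wgrp)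
qed

lemma Wsub_subset_Wgrp: "I \<subseteq> Gens \<Longrightarrow> Wsub t I \<subseteq> Wgrp t"
  by (auto simp: Wgrp_def Wsub_def)

lemma Wsub_empty: "Wsub t {} = {cls t []}"
  by (auto simp: Wsub_def)

lemma cls_Nil_in_Wsub: "cls t [] \<in> Wsub t I"
  unfolding Wsub_def by force

lemma finite_length_level:
  assumes "D \<subseteq> Wgrp t"
  shows "finite {w \<in> D. len w = n}"
proof (rule finite_subset)
  show "{w \<in> D. len w = n} \<subseteq> cls t ` {xs. set xs \<subseteq> Gens \<and> length xs = n}"
  proof
    fix w assume w: "w \<in> {w \<in> D. len w = n}"
    then obtain xs where xs: "set xs \<subseteq> Gens" "w = cls t xs"
      using assms Wgrp_iff by blast
    obtain ys where "cls t ys = cls t xs" "length ys = len (cls t xs)" "set ys \<subseteq> Gens"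
      by (rule reduced_word_exists[OF xs(1)])
    then show "w \<in> cls t ` {xs. set xs \<subseteq> Gens \<and> length xs = n}"
      using w xs(2) by (intro image_eqI[of _ _ ys]) auto
  qed
  show "finite (cls t ` {xs. set xs \<subseteq> Gens \<and> length xs = n})"
    by (intro finite_imageI finite_lists_length_eq) (simp add: Gens_def)
qed

definition minrep :: "afftype \<Rightarrow> nat set \<Rightarrow> nat list set set" where
  "minrep t I = {cls t xs | xs. set xs \<subseteq> Gens \<and> (\<forall>s\<in>I. left_ascent t s xs)}"

lemma minrep_subset_Wgrp: "minrep t I \<subseteq> Wgrp t"
  unfolding minrep_def Wgrp_def Wsub_def by blast

lemma cls_in_minrep_iff:
  assumes "set xs \<subseteq> Gens"
  shows "cls t xs \<in> minrep t I \<longleftrightarrow> (\<forall>s\<in>I. left_ascent t s xs)"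
  using assms left_ascent_cong unfolding minrep_def by blast

lemma minrep_Int: "minrep t I \<inter> minrep t J = minrep t (I \<union> J)"
proof -
  have "w \<in> minrep t I \<inter> minrep t J \<longleftrightarrow> w \<in> minrep t (I \<union> J)" if "w \<in> Wgrp t" for w
    using that unfolding Wgrp_iff by (auto simp: cls_in_minrep_iff)
  then show ?thesis using minrep_subset_Wgrp by blast
qed

lemma minrep_Gens: "minrep t Gens = {cls t []}"
proof -
  have "cls t xs = cls t []"
    if xs: "set xs \<subseteq> Gens" and ascents: "\<forall>s\<in>Gens. left_ascent t s xs" for xs
  proof (rule ccontr)
    assume "cls t xs \<noteq> cls t []"
    then obtain s where "s \<in> Gens" "\<not> left_ascent t s xs"
      by (rule left_descent_exists[OF xs])
    then show False using ascents by blast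
  qed
  moreover have "cls t [] \<in> minrep t Gens"
    by (simp add: cls_in_minrep_iff left_ascent_Nil)
  ultimately show ?thesis unfolding minrep_def by blast
qed

lemma Wgrp_eq_minreps: "Wgrp t = minrep t {1} \<union> minrep t {2} \<union> minrep t {3}"
proof
  show "Wgrp t \<subseteq> minrep t {1} \<union> minrep t {2} \<union> minrep t {3}"
  proof
    fix w assume "w \<in> Wgrp t"
    then obtain xs where xs: "set xs \<subseteq> Gens" "w = cls t xs"
      unfolding Wgrp_iff by blast
    obtain s where "s \<in> Gens" "left_ascent t s xs"
      by (rule left_ascent_exists[OF xs(1)])
    then show "w \<in> minrep t {1} \<union> minrep t {2} \<union> minrep t {3}"
      using xs by (auto simp: cls_in_minrep_iff Gens_def)
  qed
qed (use minrep_subset_Wgrp in blast)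

definition length_additive_bij ::
  "afftype \<Rightarrow> nat list set set \<Rightarrow> nat list set set \<Rightarrow> nat list set set \<Rightarrow> bool" where
  "length_additive_bij t A B C \<longleftrightarrow>
     bij_betw (\<lambda>(v, w). wmul t v w) (A \<times> B) C \<and>
     (\<forall>v\<in>A. \<forall>w\<in>B. len (wmul t v w) = len v + len w)"

lemma length_additive_bijI:
  assumes "\<And>v w. v \<in> A \<Longrightarrow> w \<in> B \<Longrightarrow> len (wmul t v w) = len v + len w"
    and "\<And>v w v' w'. v \<in> A \<Longrightarrow> w \<in> B \<Longrightarrow> v' \<in> A \<Longrightarrow> w' \<in> B \<Longrightarrow> wmul t v w = wmul t v' w' \<Longrightarrow>
      v = v' \<and> w = w'"
    and "\<And>v w. v \<in> A \<Longrightarrow> w \<in> B \<Longrightarrow> wmul t v w \<in> C"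
    and "\<And>c. c \<in> C \<Longrightarrow> \<exists>v\<in>A. \<exists>w\<in>B. c = wmul t v w"
  shows "length_additive_bij t A B C"
proof -
  have "inj_on (\<lambda>(v, w). wmul t v w) (A \<times> B)"
    using assms(2) by (force intro!: inj_onI)
  moreover have "(\<lambda>(v, w). wmul t v w) ` (A \<times> B) = C"
    using assms(3,4) by (force simp: image_iff)
  ultimately show ?thesis
    using assms(1) by (simp add: length_additive_bij_def bij_betw_def)
qed

lemma bij_betw_length_level:
  assumes "length_additive_bij t A B C"
  shows "bij_betw (\<lambda>(i, v, w). wmul t v w)
    (SIGMA i:{..n}. {v\<in>A. len v = i} \<times> {w\<in>B. len w = n - i}) {w\<in>C. len w = n}"
    (is "bij_betw ?g ?P ?L")
  unfolding bij_betw_def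
proof
  have inj: "inj_on (\<lambda>(v, w). wmul t v w) (A \<times> B)"
    and C: "C = (\<lambda>(v, w). wmul t v w) ` (A \<times> B)"
    and len_mul: "v \<in> A \<Longrightarrow> w \<in> B \<Longrightarrow> len (wmul t v w) = len v + len w" for v w
    using assms by (auto simp: length_additive_bij_def bij_betw_def)
  show "inj_on ?g ?P"
    using inj unfolding inj_on_def by auto
  show "?g ` ?P = ?L"
  proof
    show "?g ` ?P \<subseteq> ?L"
      unfolding C by (auto simp: len_mul)
    show "?L \<subseteq> ?g ` ?P"
    proof
      fix c assume "c \<in> ?L"
      then obtain v w where vw: "v \<in> A" "w \<in> B" "c = wmul t v w" "len c = n"
        unfolding C by auto
      then have "(len v, v, w) \<in> ?P"
        using len_mul by auto
      then show "c \<in> ?g ` ?P"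
        by (rule rev_image_eqI) (simp add: vw(3))
    qed
  qed
qed

lemma length_additive_bij_parabolic:
  assumes "s \<in> Gens" "r \<in> Gens"
  shows "length_additive_bij t (Wsub t {s, r}) (minrep t {s, r}) (Wgrp t)"
proof (rule length_additive_bijI)
  fix v w assume v: "v \<in> Wsub t {s, r}" and w: "w \<in> minrep t {s, r}"
  obtain us where us: "v = cls t us" "set us \<subseteq> {s, r}"
    using v unfolding Wsub_def by blast
  obtain vs where vs: "w = cls t vs" "set vs \<subseteq> Gens"
      "left_ascent t s vs" "left_ascent t r vs"
    using w unfolding minrep_def by auto
  show "len (wmul t v w) = len v + len w"
    using len_parabolic_append[OF assms us(2) vs(2-4)] by (simp add: us vs wmul_cls)
  show "wmul t v w \<in> Wgrp t"
    using us vs assms by (auto simp: wmul_cls intro!: cls_in_Wgrp)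
  fix v' w' assume v': "v' \<in> Wsub t {s, r}" and w': "w' \<in> minrep t {s, r}"
    and eq: "wmul t v w = wmul t v' w'"
  obtain us' where us': "v' = cls t us'" "set us' \<subseteq> {s, r}"
    using v' unfolding Wsub_def by blast
  obtain vs' where vs': "w' = cls t vs'" "set vs' \<subseteq> Gens"
      "left_ascent t s vs'" "left_ascent t r vs'"
    using w' unfolding minrep_def by auto
  show "v = v' \<and> w = w'"
    using coset_decomposition_unique[OF assms us(2) us'(2) vs(2-4) vs'(2-4)] eq
    by (simp add: us(1) us'(1) vs(1) vs'(1) wmul_cls)
next
  fix c assume "c \<in> Wgrp t"
  then obtain xs where xs: "set xs \<subseteq> Gens" "c = cls t xs"
    unfolding Wgrp_iff by blast
  obtain us vs where us: "set us \<subseteq> {s, r}"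
    and vs: "set vs \<subseteq> Gens" "\<forall>a\<in>{s, r}. left_ascent t a vs" and eq: "cls t xs = cls t (us @ vs)"
    by (rule coset_decomposition[of "{s, r}" xs t]) (use assms xs(1) in auto)
  have "cls t us \<in> Wsub t {s, r}" "cls t vs \<in> minrep t {s, r}"
    using us vs by (auto simp: Wsub_def cls_in_minrep_iff)
  then show "\<exists>v\<in>Wsub t {s, r}. \<exists>w\<in>minrep t {s, r}. c = wmul t v w"
    using eq xs(2) wmul_cls by metis
qed

lemma Wsub_dihedral:
  assumes "s \<in> Gens" "r \<in> Gens"
  shows "Wsub t {s, r} = (\<lambda>k. cls t (alt s r k)) ` {..cox_m t s r}
           \<union> (\<lambda>k. cls t (alt r s k)) ` {1..<cox_m t s r}"
    (is "?L = ?A \<union> ?B")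
proof
  show "?L \<subseteq> ?A \<union> ?B"
  proof
    fix w assume "w \<in> ?L"
    then obtain xs where xs: "set xs \<subseteq> {s, r}" "w = cls t xs" unfolding Wsub_def by blast
    obtain a b k where k: "{a, b} = {s, r}" "k \<le> cox_m t s r" "cls t xs = cls t (alt a b k)"
      by (rule cls_eq_alt[OF assms xs(1)])
    consider (from_s) "a = s" "b = r" | (empty) "a = r" "b = s" "k = 0"
      | (longest) "a = r" "b = s" "k = cox_m t s r"
      | (from_r) "a = r" "b = s" "k \<in> {1..<cox_m t s r}"
      using k(1,2) by (cases "k = 0") (auto simp: doubleton_eq_iff le_less[of k "cox_m t s r"])
    then show "w \<in> ?A \<union> ?B"
    proof cases
      case empty
      then show ?thesis using k(3) xs(2) by force
    next
      case longest
      then show ?thesis using k(3) xs(2) cls_braid[OF assms, of t] by auto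
    qed (use k xs(2) in auto)
  qed
  have "cls t (alt s r k) \<in> ?L" "cls t (alt r s k) \<in> ?L" for k
    using set_alt[of s r k] set_alt[of r s k] unfolding Wsub_def by blast+
  then show "?A \<union> ?B \<subseteq> ?L" by auto
qed

lemma cls_alt_neq:
  assumes "s \<in> Gens" "r \<in> Gens" "s \<noteq> r" "0 < k" "k < cox_m t s r"
  shows "cls t (alt s r k) \<noteq> cls t (alt r s k)"
proof
  assume eq: "cls t (alt s r k) = cls t (alt r s k)"
  obtain n where n: "k = Suc n" using assms(4) by (cases k) auto
  have Gens: "set (alt r s i) \<subseteq> Gens" for i
    by (rule set_alt_subset_Gens[OF assms(2,1)])
  have "left_ascent t s (alt r s k)" "left_ascent t s (alt r s n)"
    using act_word_alt_pos[OF assms(1-3), of "\<lambda>_. 1"] assms(1,5) n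
    by (auto simp: left_ascent_iff_orbit_pos[OF assms(1) Gens] orbit_def simp del: alt.simps)
  then show False
    using left_ascent_cong[OF eq, of s] left_ascent_Cons_iff[OF assms(1) Gens, of t n] n by simp
qed

lemma Hset_eq_word_powers: "Hset t i = range (\<lambda>k. cls t (word_power (wword t i) k))"
  by (auto simp: Hset_def word_power_def)

lemma cls_word_power_in_Wgrp: "set xs \<subseteq> Gens \<Longrightarrow> cls t (word_power xs k) \<in> Wgrp t"
  using set_word_power_subset[of xs k] by (blast intro: cls_in_Wgrp)

lemma inj_word_powers_if_straight:
  assumes "straight t xs" "xs \<noteq> []"
  shows "inj (\<lambda>k. cls t (word_power xs k))"
proof (rule injI)
  fix j k assume "cls t (word_power xs j) = cls t (word_power xs k)"
  then have "j * length xs = k * length xs"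
    using assms(1) unfolding straight_def by metis
  then show "j = k" using assms(2) by simp
qed

lemma length_additive_bij_straight:
  assumes "straight t xs" "xs \<noteq> []"
  defines "p \<equiv> \<lambda>k. cls t (word_power xs k)"
  shows "length_additive_bij t {cls t xs} (range p) (range (\<lambda>k. p (Suc k)))"
proof -
  have mul: "wmul t (cls t xs) (p k) = p (Suc k)" for k
    by (simp add: p_def wmul_cls)
  have len: "len (p k) = k * length xs" for k
    using assms(1) by (simp add: p_def straight_def)
  have "p 1 = cls t xs"
    by (simp add: p_def)
  then have len_xs: "len (cls t xs) = length xs"
    using len[of 1] by simp
  have inj: "p j = p k \<longleftrightarrow> j = k" for j k
    using inj_word_powers_if_straight[OF assms(1,2)] unfolding p_def by (auto dest: injD)
  show ?thesis
    by (rule length_additive_bijI) (auto simp: mul len len_xs inj)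
qed

section \<open>Power series of additive endomorphisms\<close>

text \<open>This is not an instance of \<open>ring_1\<close>, because \<open>0 = 1\<close> when the space is trivial.\<close>

typedef (overloaded) 'v opseries = "{A :: nat \<Rightarrow> 'v::ab_group_add \<Rightarrow> 'v. \<forall>n. additive (A n)}"
  morphisms coeffs Opseries
  by (rule exI[of _ "\<lambda>_ _. 0"]) (simp add: additive_def)

setup_lifting type_definition_opseries

lemma ps_mult_assoc:
  fixes A B C :: "nat \<Rightarrow> 'v::ab_group_add \<Rightarrow> 'v"
  assumes "\<And>n. additive (A n)"
  shows "ps_mult (ps_mult A B) C = ps_mult A (ps_mult B C)"
proof (intro ext)
  fix n x
  show "ps_mult (ps_mult A B) C n x = ps_mult A (ps_mult B C) n x"
    using fps_mult_assoc_lemma[of "\<lambda>i j k. A i (B j (C k x))" n n]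
    by (simp add: ps_mult_def additive.sum[OF assms] atLeast0AtMost)
qed

lemma ps_mult_one_left: "ps_mult ps_one A = (A :: nat \<Rightarrow> 'v \<Rightarrow> 'v::comm_monoid_add)"
proof (intro ext)
  fix n x
  have "ps_mult ps_one A n x = (\<Sum>i\<le>n. if i = 0 then A n x else 0)"
    unfolding ps_mult_def by (rule sum.cong) (auto simp: ps_one_def)
  then show "ps_mult ps_one A n x = A n x" by simp
qed

lemma ps_mult_one_right:
  fixes A :: "nat \<Rightarrow> 'v::ab_group_add \<Rightarrow> 'v"
  assumes "\<And>n. additive (A n)"
  shows "ps_mult A ps_one = A"
proof (intro ext)
  fix n x
  have "ps_mult A ps_one n x = (\<Sum>i\<le>n. if i = n then A n x else 0)"
    unfolding ps_mult_def by (rule sum.cong) (auto simp: ps_one_def additive.zero[OF assms])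
  then show "ps_mult A ps_one n x = A n x" by simp
qed

instantiation opseries :: (ab_group_add) "{ring, monoid_mult}"
begin

lift_definition zero_opseries :: "'a opseries" is "\<lambda>_ _. 0"
  by (simp add: additive_def)

lift_definition one_opseries :: "'a opseries" is ps_one
  by (simp add: ps_one_def additive_def)

lift_definition plus_opseries :: "'a opseries \<Rightarrow> 'a opseries \<Rightarrow> 'a opseries"
  is "\<lambda>A B n x. A n x + B n x"
  by (simp add: additive_def algebra_simps)

lift_definition minus_opseries :: "'a opseries \<Rightarrow> 'a opseries \<Rightarrow> 'a opseries"
  is "\<lambda>A B n x. A n x - B n x"
  by (simp add: additive_def algebra_simps)

lift_definition uminus_opseries :: "'a opseries \<Rightarrow> 'a opseries" is "\<lambda>A n x. - A n x"
  by (simp add: additive_def)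

lift_definition times_opseries :: "'a opseries \<Rightarrow> 'a opseries \<Rightarrow> 'a opseries" is ps_mult
  by (simp add: ps_mult_def additive_def sum.distrib)

instance
proof
  fix A B C :: "'a opseries"
  show "A * B * C = A * (B * C)"
    by transfer (rule ps_mult_assoc, blast)
  show "(A + B) * C = A * C + B * C"
    by transfer (simp add: ps_mult_def sum.distrib fun_eq_iff)
  show "A * (B + C) = A * B + A * C"
    by transfer (simp add: ps_mult_def additive_def sum.distrib fun_eq_iff)
  show "1 * A = A"
    by transfer (rule ps_mult_one_left)
  show "A * 1 = A"
    by transfer (rule ps_mult_one_right, blast)
qed (transfer; auto simp: algebra_simps)+

end

lemma additive_coeffs: "additive (coeffs A n)"
  using coeffs[of A] by simp

fun left_inverse_coeffs :: "(nat \<Rightarrow> 'v \<Rightarrow> 'v) \<Rightarrow> nat \<Rightarrow> 'v \<Rightarrow> 'v::ab_group_add" where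
  "left_inverse_coeffs A n x =
     (if n = 0 then x else - (\<Sum>i<n. left_inverse_coeffs A i (A (n - i) x)))"

declare left_inverse_coeffs.simps [simp del]

lift_definition left_inverse :: "'v::ab_group_add opseries \<Rightarrow> 'v opseries" is left_inverse_coeffs
proof
  fix A :: "nat \<Rightarrow> 'v \<Rightarrow> 'v" and n x y
  assume A: "\<And>n. additive (A n)"
  show "left_inverse_coeffs A n (x + y) = left_inverse_coeffs A n x + left_inverse_coeffs A n y"
  proof (induction n arbitrary: x y rule: less_induct)
    case (less n)
    then show ?case
      by (subst (1 2 3) left_inverse_coeffs.simps) (simp add: additive.add[OF A] sum.distrib)
  qed
qed

lemma coeffs_left_inverse_0: "coeffs (left_inverse A) 0 = id"
  by (auto simp: left_inverse.rep_eq left_inverse_coeffs.simps)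

lemma left_inverse_mult:
  assumes "coeffs A 0 = id"
  shows "left_inverse A * A = 1"
proof -
  have "ps_mult (left_inverse_coeffs (coeffs A)) (coeffs A) n x = ps_one n x" for n x
  proof (cases "n = 0")
    case True
    then show ?thesis
      using assms by (simp add: ps_mult_def ps_one_def left_inverse_coeffs.simps)
  next
    case False
    then show ?thesis
      using assms
      by (simp add: ps_mult_def ps_one_def left_inverse_coeffs.simps[of _ n]
          flip: lessThan_Suc_atMost)
  qed
  then show ?thesis
    by (simp add: coeffs_inject[symmetric] times_opseries.rep_eq one_opseries.rep_eq
        left_inverse.rep_eq fun_eq_iff)
qed

lemma invertible_opseries:
  assumes "coeffs A 0 = id"
  shows "invertible A"
proof -
  have "left_inverse (left_inverse A) * left_inverse A = 1"
    by (rule left_inverse_mult[OF coeffs_left_inverse_0])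
  then have "left_inverse (left_inverse A) = A"
    using left_inverse_eq_right_inverse left_inverse_mult[OF assms] by blast
  then show ?thesis
    using left_inverse_mult[OF assms] left_inverse_mult[OF coeffs_left_inverse_0, of A]
    unfolding invertible_def by metis
qed

text \<open>\<open>ps_inv\<close> ranges over all sequences of functions; that the inverse is nevertheless unique
  uses additivity of the known inverse only.\<close>

lemma ps_inv_coeffs:
  fixes A :: "'v::ab_group_add opseries"
  assumes "invertible A"
  shows "ps_inv (coeffs A) = coeffs (uinv A)"
  unfolding ps_inv_def
proof (rule the_equality)
  let ?B = "uinv A"
  have inv: "ps_mult (coeffs A) (coeffs ?B) = ps_one" "ps_mult (coeffs ?B) (coeffs A) = ps_one"
    using mult_uinv[OF assms] by (simp_all flip: times_opseries.rep_eq one_opseries.rep_eq)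
  then show "ps_mult (coeffs A) (coeffs ?B) = ps_one \<and> ps_mult (coeffs ?B) (coeffs A) = ps_one"
    by blast
  fix C assume C: "ps_mult (coeffs A) C = ps_one \<and> ps_mult C (coeffs A) = ps_one"
  have "C = ps_mult (ps_mult (coeffs ?B) (coeffs A)) C"
    unfolding inv by (simp add: ps_mult_one_left)
  also have "\<dots> = ps_mult (coeffs ?B) ps_one"
    using C by (simp add: ps_mult_assoc additive_coeffs)
  also have "\<dots> = coeffs ?B"
    by (simp add: ps_mult_one_right additive_coeffs)
  finally show "C = coeffs ?B" .
qed

lemma ps_prod_coeffs: "ps_prod (map coeffs As) = coeffs (prod_list As)"
  by (induction As) (simp_all add: ps_prod_def times_opseries.rep_eq one_opseries.rep_eq)

section \<open>Series of a representation\<close>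

locale braid_rep =
  fixes t :: afftype and \<rho> :: "nat list set \<Rightarrow> 'v::ab_group_add \<Rightarrow> 'v"
  assumes additive_rho: "w \<in> Wgrp t \<Longrightarrow> additive (\<rho> w)"
    and rho_one: "\<rho> (cls t []) = id"
    and rho_wmul: "\<lbrakk>v \<in> Wgrp t; w \<in> Wgrp t; len (wmul t v w) = len v + len w\<rbrakk> \<Longrightarrow>
      \<rho> (wmul t v w) = \<rho> v \<circ> \<rho> w"

lemma braid_rep_if_hecke_rep:
  assumes "hecke_rep t scale q \<rho>"
  shows "braid_rep t \<rho>"
proof
  fix w assume "w \<in> Wgrp t"
  then show "\<And>x y. \<rho> w (x + y) = \<rho> w x + \<rho> w y"
    using assms unfolding hecke_rep_def
    by (auto simp: Vector_Spaces.linear_def module_hom_def module_hom_axioms_def)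
next
  show "\<rho> (cls t []) = id"
    using assms unfolding hecke_rep_def by blast
next
  fix v w assume "v \<in> Wgrp t" "w \<in> Wgrp t" and len: "len (wmul t v w) = len v + len w"
  then obtain xs ys where words: "set xs \<subseteq> Gens" "v = cls t xs" "set ys \<subseteq> Gens" "w = cls t ys"
    unfolding Wgrp_iff by blast
  then show "\<rho> (wmul t v w) = \<rho> v \<circ> \<rho> w"
    using assms len unfolding hecke_rep_def by (simp add: wmul_cls)
qed

context braid_rep
begin

definition series :: "nat list set set \<Rightarrow> 'v opseries" where
  "series D = Opseries (ser \<rho> D)"

lemma coeffs_series:
  assumes "D \<subseteq> Wgrp t"
  shows "coeffs (series D) = ser \<rho> D"
  unfolding series_def
proof (rule Opseries_inverse)
  have "ser \<rho> D n (x + y) = ser \<rho> D n x + ser \<rho> D n y" for n x y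
    unfolding ser_def sum.distrib[symmetric]
    by (rule sum.cong) (use assms in \<open>auto intro: additive.add[OF additive_rho]\<close>)
  then show "ser \<rho> D \<in> {A. \<forall>n. additive (A n)}" by (simp add: additive_def)
qed

lemma series_eqI:
  assumes "D \<subseteq> Wgrp t" "\<And>n x. coeffs B n x = (\<Sum>w\<in>{w\<in>D. len w = n}. \<rho> w x)"
  shows "B = series D"
  unfolding coeffs_inject[symmetric] coeffs_series[OF assms(1)]
  by (intro ext) (simp add: ser_def assms(2))

lemma series_one: "series {cls t []} = 1"
proof (rule series_eqI[symmetric])
  show "{cls t []} \<subseteq> Wgrp t" by (simp add: cls_in_Wgrp)
  fix n x
  have "{w \<in> {cls t []}. len w = n} = (if n = 0 then {cls t []} else {})" by auto
  then show "coeffs 1 n x = (\<Sum>w\<in>{w \<in> {cls t []}. len w = n}. \<rho> w x)"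
    by (simp add: one_opseries.rep_eq ps_one_def rho_one)
qed

lemma invertible_series:
  assumes "D \<subseteq> Wgrp t" "cls t [] \<in> D"
  shows "invertible (series D)"
proof (rule invertible_opseries)
  have "{w \<in> D. len w = 0} = {cls t []}"
    using assms len_eq_0_iff by (force simp: Wgrp_iff subset_iff)
  then show "coeffs (series D) 0 = id"
    by (simp add: coeffs_series assms(1) ser_def rho_one id_def)
qed

lemma series_Un_Int:
  assumes "A \<subseteq> Wgrp t" "B \<subseteq> Wgrp t"
  shows "series (A \<union> B) + series (A \<inter> B) = series A + series B"
proof -
  have AB: "A \<union> B \<subseteq> Wgrp t" "A \<inter> B \<subseteq> Wgrp t" using assms by auto
  have "ser \<rho> (A \<union> B) n x + ser \<rho> (A \<inter> B) n x = ser \<rho> A n x + ser \<rho> B n x" for n x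
  proof -
    have levels: "{w \<in> A \<union> B. len w = n} = {w \<in> A. len w = n} \<union> {w \<in> B. len w = n}"
      "{w \<in> A \<inter> B. len w = n} = {w \<in> A. len w = n} \<inter> {w \<in> B. len w = n}"
      by auto
    show ?thesis
      unfolding ser_def levels by (rule sum.union_inter; rule finite_length_level; rule assms)
  qed
  then show ?thesis
    by (simp add: coeffs_inject[symmetric] plus_opseries.rep_eq coeffs_series assms AB)
qed

lemma series_empty: "series {} = 0"
  by (rule series_eqI[symmetric]) (simp_all add: zero_opseries.rep_eq)

lemma series_Un_disjoint:
  "A \<subseteq> Wgrp t \<Longrightarrow> B \<subseteq> Wgrp t \<Longrightarrow> A \<inter> B = {} \<Longrightarrow> series (A \<union> B) = series A + series B"
  using series_Un_Int[of A B] by (simp add: series_empty)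

lemma series_Un3:
  assumes "A \<subseteq> Wgrp t" "B \<subseteq> Wgrp t" "C \<subseteq> Wgrp t"
  shows "series (A \<union> B \<union> C) = series A + series B + series C
    - series (A \<inter> B) - series (A \<inter> C) - series (B \<inter> C) + series (A \<inter> B \<inter> C)"
proof -
  have "series (A \<union> B) = series A + series B - series (A \<inter> B)"
    using series_Un_Int[OF assms(1,2)] by (simp add: eq_diff_eq)
  moreover have "series (A \<union> B \<union> C) = series (A \<union> B) + series C - series ((A \<union> B) \<inter> C)"
    using series_Un_Int[of "A \<union> B" C] assms by (simp add: eq_diff_eq)
  moreover have "series ((A \<union> B) \<inter> C)
      = series (A \<inter> C) + series (B \<inter> C) - series ((A \<inter> C) \<inter> (B \<inter> C))"
    using series_Un_Int[of "A \<inter> C" "B \<inter> C"] assms by (auto simp: eq_diff_eq Int_Un_distrib2)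
  moreover have "(A \<inter> C) \<inter> (B \<inter> C) = A \<inter> B \<inter> C"
    by blast
  ultimately show ?thesis by simp
qed

lemma series_image:
  assumes "finite K" "inj_on f K" "f ` K \<subseteq> Wgrp t"
  shows "series (f ` K) = (\<Sum>k\<in>K. series {f k})"
  using assms
proof (induction K rule: finite_induct)
  case (insert k K)
  have "series (f ` insert k K) = series ({f k} \<union> f ` K)" by simp
  also have "\<dots> = series {f k} + series (f ` K)"
    by (rule series_Un_disjoint) (use insert in auto)
  finally show ?case using insert by simp
qed (simp add: series_empty)

lemma series_mult:
  assumes A: "A \<subseteq> Wgrp t" and B: "B \<subseteq> Wgrp t" and mul: "length_additive_bij t A B C"
  shows "series A * series B = series C"
proof (rule series_eqI)
  show "C \<subseteq> Wgrp t"
    using mul A B by (auto simp: length_additive_bij_def bij_betw_def intro!: wmul_in_Wgrp)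
  fix n x
  let ?A = "\<lambda>i. {v\<in>A. len v = i}" and ?B = "\<lambda>i. {w\<in>B. len w = i}"
  have rho: "\<rho> v (\<Sum>w\<in>?B i. \<rho> w x) = (\<Sum>w\<in>?B i. \<rho> (wmul t v w) x)" if "v \<in> A" for v i
  proof -
    have "additive (\<rho> v)"
      using that A additive_rho by blast
    then have "\<rho> v (\<Sum>w\<in>?B i. \<rho> w x) = (\<Sum>w\<in>?B i. \<rho> v (\<rho> w x))"
      by (rule additive.sum)
    also have "\<dots> = (\<Sum>w\<in>?B i. \<rho> (wmul t v w) x)"
      by (rule sum.cong)
        (use that A B mul in \<open>auto simp: rho_wmul subset_eq length_additive_bij_def\<close>)
    finally show ?thesis .
  qed
  have fin: "finite (?A i)" "finite (?B i)" for i
    by (rule finite_length_level[OF A], rule finite_length_level[OF B])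
  have "coeffs (series A * series B) n x = (\<Sum>i\<le>n. \<Sum>v\<in>?A i. \<rho> v (\<Sum>w\<in>?B (n - i). \<rho> w x))"
    by (simp add: times_opseries.rep_eq ps_mult_def coeffs_series A B) (simp add: ser_def)
  also have "\<dots> = (\<Sum>i\<le>n. \<Sum>v\<in>?A i. \<Sum>w\<in>?B (n - i). \<rho> (wmul t v w) x)"
    by (intro sum.cong HOL.refl) (use rho in auto)
  also have "\<dots> = (\<Sum>(i, v, w)\<in>(SIGMA i:{..n}. ?A i \<times> ?B (n - i)). \<rho> (wmul t v w) x)"
    by (simp add: sum.Sigma fin sum.cartesian_product case_prod_unfold)
  also have "\<dots> = (\<Sum>w\<in>{w\<in>C. len w = n}. \<rho> w x)"
    using sum.reindex_bij_betw[OF bij_betw_length_level[OF mul, of n], of "\<lambda>w. \<rho> w x"]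
    by (simp add: case_prod_unfold)
  finally show "coeffs (series A * series B) n x = (\<Sum>w\<in>{w\<in>C. len w = n}. \<rho> w x)" .
qed

definition gen :: "nat \<Rightarrow> 'v opseries" where
  "gen s = series {cls t [s]}"

definition word_series :: "nat list \<Rightarrow> 'v opseries" where
  "word_series xs = prod_list (map gen xs)"

lemma word_series_simps [simp]:
  "word_series [] = 1" "word_series (s # xs) = gen s * word_series xs"
  by (simp_all add: word_series_def)

lemma series_reduced_word:
  assumes "set xs \<subseteq> Gens" "len (cls t xs) = length xs"
  shows "series {cls t xs} = word_series xs"
  using assms
proof (induction xs)
  case Nil
  then show ?case by (simp add: series_one)
next
  case (Cons s xs)
  have s: "s \<in> Gens" "set xs \<subseteq> Gens" using Cons.prems by auto
  have len: "len (cls t xs) = length xs"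
    using len_Cons_cases[OF s, of t] len_cls_le[of t xs] Cons.prems(2) by auto
  have "length_additive_bij t {cls t [s]} {cls t xs} {cls t (s # xs)}"
    using Cons.prems(2) len len_singleton[OF s(1), of t]
    by (intro length_additive_bijI) (auto simp: wmul_cls)
  then have "gen s * series {cls t xs} = series {cls t (s # xs)}"
    unfolding gen_def using s by (intro series_mult) (simp_all add: cls_in_Wgrp)
  then show ?case
    using Cons.IH s(2) len by simp
qed

lemma word_series_alt: "word_series (alt s r k) = alt_prod (gen s) (gen r) k"
  by (induction k arbitrary: s r) simp_all

lemma series_alt:
  assumes "s \<in> Gens" "r \<in> Gens" "k \<le> cox_m t s r"
  shows "series {cls t (alt s r k)} = alt_prod (gen s) (gen r) k"
  using series_reduced_word[OF set_alt_subset_Gens[OF assms(1,2)], of k] len_alt[OF assms]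
  by (simp add: word_series_alt)

lemma gen_braid:
  assumes "s \<in> Gens" "r \<in> Gens"
  shows "alt_prod (gen s) (gen r) (cox_m t s r) = alt_prod (gen r) (gen s) (cox_m t s r)"
  using series_alt[OF assms, of "cox_m t s r"] series_alt[OF assms(2,1), of "cox_m t s r"]
    cls_braid[OF assms, of t] by (simp add: cox_m_sym)

lemma series_Wsub_pair:
  assumes "s \<in> Gens" "r \<in> Gens" "s \<noteq> r"
  shows "series (Wsub t {s, r}) = dihedral_sum (cox_m t s r) (gen s) (gen r)"
proof -
  let ?m = "cox_m t s r"
  let ?f = "\<lambda>k. cls t (alt s r k)" and ?g = "\<lambda>k. cls t (alt r s k)"
  have sub: "?f ` {..?m} \<subseteq> Wgrp t" "?g ` {1..<?m} \<subseteq> Wgrp t"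
    using assms set_alt_subset_Gens cls_in_Wgrp by auto
  have len: "k \<le> ?m \<Longrightarrow> len (?f k) = k" "k \<le> ?m \<Longrightarrow> len (?g k) = k" for k
    using len_alt[of s r k] len_alt[of r s k] assms by (auto simp: cox_m_sym[of t r s])
  have "?f j \<noteq> ?g k" if "j \<le> ?m" "k \<in> {1..<?m}" for j k
    using that len(1)[of j] len(2)[of k] cls_alt_neq[OF assms, of k t] by fastforce
  then have disj: "?f ` {..?m} \<inter> ?g ` {1..<?m} = {}"
    by blast
  have inj: "inj_on ?f {..?m}" "inj_on ?g {1..<?m}"
    by (auto intro!: inj_on_inverseI[of _ len] simp: len)
  have "series (Wsub t {s, r}) = series (?f ` {..?m}) + series (?g ` {1..<?m})"
    unfolding Wsub_dihedral[OF assms(1,2)] by (rule series_Un_disjoint[OF sub disj])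
  also have "\<dots> = (\<Sum>k\<le>?m. series {?f k}) + (\<Sum>k=1..<?m. series {?g k})"
    using sub inj by (simp add: series_image)
  also have "\<dots> = dihedral_sum ?m (gen s) (gen r)"
    using assms by (simp add: series_alt dihedral_sum_def cox_m_sym[of t r s])
  finally show ?thesis .
qed

lemma series_Wsub_singleton:
  assumes "s \<in> Gens"
  shows "series (Wsub t {s}) = 1 + gen s"
proof -
  have "cls t [] \<noteq> cls t [s]"
    using len_singleton[OF assms, of t] len_Nil[of t] by fastforce
  moreover have "Wsub t {s} = {cls t []} \<union> {cls t [s]}"
    using Wsub_dihedral[OF assms assms, of t] by (auto simp: cox_m_def atMost_Suc)
  ultimately show ?thesis
    using series_Un_disjoint[of "{cls t []}" "{cls t [s]}"] assms
    by (simp add: cls_in_Wgrp series_one gen_def)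
qed

lemma invertible_series_Wsub: "I \<subseteq> Gens \<Longrightarrow> invertible (series (Wsub t I))"
  by (simp add: invertible_series Wsub_subset_Wgrp cls_Nil_in_Wsub)

lemma uinv_Wsub_mult_Wgrp:
  assumes "s \<in> Gens" "r \<in> Gens"
  shows "uinv (series (Wsub t {s, r})) * series (Wgrp t) = series (minrep t {s, r})"
proof -
  have "{s, r} \<subseteq> Gens" using assms by simp
  then show ?thesis
    by (simp add: uinv_eq_iff_left invertible_series_Wsub Wsub_subset_Wgrp minrep_subset_Wgrp
        series_mult[OF _ _ length_additive_bij_parabolic[OF assms]])
qed

lemma series_Wgrp_inclusion_exclusion:
  "series (Wgrp t) - series (minrep t {1}) - series (minrep t {2}) - series (minrep t {3})
    + series (minrep t {1, 2}) + series (minrep t {1, 3}) + series (minrep t {2, 3}) = 1"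
proof -
  have "minrep t {1} \<inter> minrep t {2} \<inter> minrep t {3} = {cls t []}"
    unfolding minrep_Gens[symmetric] by (simp add: minrep_Int Gens_def insert_commute)
  then have "series (Wgrp t) = series (minrep t {1}) + series (minrep t {2}) + series (minrep t {3})
      - series (minrep t {1, 2}) - series (minrep t {1, 3}) - series (minrep t {2, 3}) + 1"
    unfolding Wgrp_eq_minreps
    using series_Un3[OF minrep_subset_Wgrp minrep_subset_Wgrp minrep_subset_Wgrp,
        of "{1}" "{2}" "{3}"]
    by (simp add: minrep_Int insert_commute series_one)
  then show ?thesis by simp
qed

lemma series_word_powers_unfold:
  assumes xs: "set xs \<subseteq> Gens" "xs \<noteq> []" and straight: "straight t xs"
  defines "p \<equiv> \<lambda>k. cls t (word_power xs k)"
  shows "series (range p) = 1 + word_series xs * series (range p)"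
proof -
  have p_in: "p k \<in> Wgrp t" for k
    unfolding p_def by (rule cls_word_power_in_Wgrp[OF xs(1)])
  have p_0: "p 0 = cls t []"
    by (simp add: p_def)
  have inj: "inj p"
    unfolding p_def by (rule inj_word_powers_if_straight[OF straight xs(2)])
  have bij: "length_additive_bij t {cls t xs} (range p) (range (\<lambda>k. p (Suc k)))"
    unfolding p_def by (rule length_additive_bij_straight[OF straight xs(2)])
  have "p k \<in> {p 0} \<union> range (\<lambda>k. p (Suc k))" for k
    by (cases k) auto
  then have "range p = {p 0} \<union> range (\<lambda>k. p (Suc k))"
    by auto
  also have "series \<dots> = series {p 0} + series (range (\<lambda>k. p (Suc k)))"
    by (rule series_Un_disjoint) (use p_in in \<open>auto simp: inj_eq[OF inj]\<close>)
  also have "series {p 0} = 1"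
    by (simp add: p_0 series_one)
  also have "series (range (\<lambda>k. p (Suc k))) = series {cls t xs} * series (range p)"
    using p_in cls_in_Wgrp[OF xs(1)] bij by (intro series_mult[symmetric]) auto
  also have "series {cls t xs} = word_series xs"
    using straight[unfolded straight_def, rule_format, of 1] by (intro series_reduced_word xs) simp
  finally show ?thesis .
qed

lemma
  assumes xs: "set xs \<subseteq> Gens" "xs \<noteq> []" and straight: "straight t xs"
  shows invertible_one_minus_straight: "invertible (1 - word_series xs)"
    and series_word_powers:
      "series (range (\<lambda>k. cls t (word_power xs k))) = uinv (1 - word_series xs)"
proof -
  let ?H = "series (range (\<lambda>k. cls t (word_power xs k)))"
  have "cls t [] = cls t (word_power xs 0)"
    by simp
  then have inv: "invertible ?H"
    using cls_word_power_in_Wgrp[OF xs(1)] by (intro invertible_series) blast+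
  have "(1 - word_series xs) * ?H = 1"
    using series_word_powers_unfold[OF assms]
    by (simp only: left_diff_distrib mult_1_left diff_eq_eq)
  then have uinv: "1 - word_series xs = uinv ?H"
    by (rule left_inverse_eq_right_inverse[OF _ mult_uinv(1)[OF inv]])
  show "invertible (1 - word_series xs)" "?H = uinv (1 - word_series xs)"
    unfolding uinv by (rule invertible_uinv[OF inv], rule uinv_uinv[OF inv, symmetric])
qed

lemma wword_neq_Nil: "wword t i \<noteq> []"
  by (cases t) (auto simp: wword_def)

lemma invertible_one_minus_wword: "invertible (1 - word_series (wword t i))"
  by (rule invertible_one_minus_straight[OF set_wword wword_neq_Nil straight_wword])

lemma series_Hset: "series (Hset t i) = uinv (1 - word_series (wword t i))"
  unfolding Hset_eq_word_powers
  by (rule series_word_powers[OF set_wword wword_neq_Nil straight_wword])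

lemma Hset_subset_Wgrp: "Hset t i \<subseteq> Wgrp t"
  unfolding Hset_eq_word_powers using cls_word_power_in_Wgrp[OF set_wword] by blast

end

section \<open>The ordered product\<close>

primrec factor_order :: "afftype \<Rightarrow> (nat + nat set) list" where
  "factor_order TA2 = [Inr {1, 2}, Inr {1}, Inl 2, Inr {1, 3}, Inr {3}, Inl 1, Inr {2}, Inr {2, 3},
     Inr {}]"
| "factor_order TC2 = [Inr {1, 2}, Inl 1, Inl 2, Inr {1}, Inr {1, 3}, Inr {2, 3}, Inr {2}, Inr {3},
     Inr {}]"
| "factor_order TG2 = [Inr {1, 2}, Inr {1}, Inl 2, Inl 1, Inr {1, 3}, Inr {2, 3}, Inr {2}, Inr {3},
     Inr {}]"

lemma distinct_factor_order: "distinct (factor_order t)"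
  by (cases t) (simp_all add: doubleton_eq_iff)

lemma psubsets_Gens: "{I. I \<subset> Gens} = {{}, {1}, {2}, {3}, {1, 2}, {1, 3}, {2, 3}}"
proof -
  have subset_doubleton: "I \<subseteq> {a, b} \<longleftrightarrow> I = {} \<or> I = {a} \<or> I = {b} \<or> I = {a, b}" for I and a b :: nat
    by blast
  have psubset_triple: "I \<subset> {a, b, c} \<longleftrightarrow> I \<subseteq> {a, b} \<or> I \<subseteq> {a, c} \<or> I \<subseteq> {b, c}"
    if "a \<noteq> b" "a \<noteq> c" "b \<noteq> c" for I and a b c :: nat
    using that by blast
  have "I \<subset> Gens \<longleftrightarrow> I \<subseteq> {1, 2} \<or> I \<subseteq> {1, 3} \<or> I \<subseteq> {2, 3}" for I
    unfolding Gens_def by (rule psubset_triple) simp_all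
  then have "I \<subset> Gens \<longleftrightarrow> I \<in> {{}, {1}, {2}, {3}, {1, 2}, {1, 3}, {2, 3}}" for I
    by (simp only: subset_doubleton insert_iff empty_iff simp_thms disj_ac disj_absorb
        disj_left_absorb)
  then show ?thesis by (simp only: set_eq_iff mem_Collect_eq simp_thms)
qed

lemma set_factor_order: "set (factor_order t) = factor_index"
  unfolding factor_index_def psubsets_Gens by (cases t) auto

context braid_rep
begin

sublocale triangle_ring "gen 1" "gen 2" "gen 3" "cox_m t 1 2" "cox_m t 1 3" "cox_m t 2 3"
proof
  show "invertible (1 + gen 1)" "invertible (1 + gen 2)" "invertible (1 + gen 3)"
    by (simp_all add: Gens_members invertible_series_Wsub flip: series_Wsub_singleton One_nat_def)
  show "invertible (dihedral_sum (cox_m t 1 2) (gen 1) (gen 2))"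
    "invertible (dihedral_sum (cox_m t 1 3) (gen 1) (gen 3))"
    "invertible (dihedral_sum (cox_m t 2 3) (gen 2) (gen 3))"
    by (simp_all add: Gens_members invertible_series_Wsub flip: series_Wsub_pair One_nat_def)
qed (rule gen_braid cox_m_pos; rule Gens_members)+

lemma alternating_inverse_sum_mult_series_Wgrp: "alternating_inverse_sum * series (Wgrp t) = 1"
proof -
  have quotient_singleton: "uinv (1 + gen s) * series (Wgrp t) = series (minrep t {s})"
    if "s \<in> Gens" for s
    using uinv_Wsub_mult_Wgrp[OF that that] by (simp add: series_Wsub_singleton[OF that])
  have quotient_pair: "uinv (dihedral_sum (cox_m t s r) (gen s) (gen r)) * series (Wgrp t)
      = series (minrep t {s, r})" if "s \<in> Gens" "r \<in> Gens" "s \<noteq> r" for s r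
    using uinv_Wsub_mult_Wgrp[OF that(1,2)] by (simp add: series_Wsub_pair[OF that])
  show ?thesis
    unfolding alternating_inverse_sum_def
    using series_Wgrp_inclusion_exclusion
    by (simp add: left_diff_distrib distrib_right quotient_singleton quotient_pair Gens_members
        del: One_nat_def)
qed

definition factor_series :: "nat + nat set \<Rightarrow> 'v opseries" where
  "factor_series a = (case a of
       Inl i \<Rightarrow> uinv (1 - word_series (wword t i))
     | Inr I \<Rightarrow> if even (card I) then series (Wsub t I) else uinv (series (Wsub t I)))"

lemma factor_eq_coeffs:
  assumes "a \<in> factor_index"
  shows "factor t \<rho> a = coeffs (factor_series a)"
proof (cases a)
  case (Inl i)
  then show ?thesis
    by (simp add: factor_def factor_series_def Hset_subset_Wgrp flip: series_Hset coeffs_series)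
next
  case (Inr I)
  then have "I \<subseteq> Gens"
    using assms by (auto simp: factor_index_def)
  then have "coeffs (series (Wsub t I)) = ser \<rho> (Wsub t I)" "invertible (series (Wsub t I))"
    by (simp_all add: coeffs_series Wsub_subset_Wgrp invertible_series_Wsub)
  then show ?thesis
    using Inr by (simp add: factor_def factor_series_def flip: ps_inv_coeffs)
qed

lemma factor_series_simps:
  "factor_series (Inl i) = uinv (1 - word_series (wword t i))"
  "factor_series (Inr {}) = 1"
  "s \<in> Gens \<Longrightarrow> factor_series (Inr {s}) = uinv (1 + gen s)"
  "\<lbrakk>s \<in> Gens; r \<in> Gens; s \<noteq> r\<rbrakk> \<Longrightarrow>
    factor_series (Inr {s, r}) = dihedral_sum (cox_m t s r) (gen s) (gen r)"
  by (simp_all add: factor_series_def Wsub_empty series_one series_Wsub_singleton series_Wsub_pair)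

lemma prod_factor_series_TA2:
  assumes "t = TA2"
  shows "prod_list (map factor_series (factor_order t)) = series (Wgrp t)"
proof -
  let ?x = "gen 1" and ?y = "gen 2" and ?z = "gen 3"
  have orders: "cox_m t 1 2 = 3" "cox_m t 1 3 = 3" "cox_m t 2 3 = 3"
    and words: "wword t 1 = [3, 2, 1]" "wword t 2 = [3, 1, 2]"
    by (simp_all add: assms cox_m_def doubleton_eq_iff wword_def)
  have "prod_list (map factor_series (factor_order t)) = w12 * ix * uinv (1 - ?z * ?x * ?y)
      * w13 * iz * uinv (1 - ?z * ?y * ?x) * iy * w23"
    by (simp add: arg_cong[OF assms, of factor_order] words factor_series_simps Gens_members
        mult.assoc del: One_nat_def)
  also have "\<dots> = series (Wgrp t)"
    by (rule right_inverse_eq_product_333[OF orders alternating_inverse_sum_mult_series_Wgrp,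
        symmetric])
      (use invertible_one_minus_wword[of 1] invertible_one_minus_wword[of 2] in
        \<open>simp_all add: words mult.assoc del: One_nat_def\<close>)
  finally show ?thesis .
qed

lemma prod_factor_series_TC2:
  assumes "t = TC2"
  shows "prod_list (map factor_series (factor_order t)) = series (Wgrp t)"
proof -
  let ?x = "gen 1" and ?y = "gen 2" and ?z = "gen 3"
  have orders: "cox_m t 1 2 = 4" "cox_m t 1 3 = 4" "cox_m t 2 3 = 2"
    and words: "wword t 1 = [3, 1, 2, 1]" "wword t 2 = [3, 1, 2]"
    by (simp_all add: assms cox_m_def doubleton_eq_iff wword_def)
  have "prod_list (map factor_series (factor_order t)) = w12 * uinv (1 - ?z * ?x * ?y * ?x)
      * uinv (1 - ?z * ?x * ?y) * ix * w13 * w23 * iy * iz"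
    by (simp add: arg_cong[OF assms, of factor_order] words factor_series_simps Gens_members
        mult.assoc del: One_nat_def)
  also have "\<dots> = series (Wgrp t)"
    by (rule right_inverse_eq_product_442[OF orders alternating_inverse_sum_mult_series_Wgrp,
        symmetric])
      (use invertible_one_minus_wword[of 1] invertible_one_minus_wword[of 2] in
        \<open>simp_all add: words mult.assoc del: One_nat_def\<close>)
  finally show ?thesis .
qed

lemma prod_factor_series_TG2:
  assumes "t = TG2"
  shows "prod_list (map factor_series (factor_order t)) = series (Wgrp t)"
proof -
  let ?x = "gen 1" and ?y = "gen 2" and ?z = "gen 3"
  have orders: "cox_m t 1 2 = 6" "cox_m t 1 3 = 3" "cox_m t 2 3 = 2"
    and words: "wword t 1 = [3, 1, 2]" "wword t 2 = [3, 1, 2, 1, 2]"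
    by (simp_all add: assms cox_m_def doubleton_eq_iff wword_def)
  have "prod_list (map factor_series (factor_order t)) = w12 * ix
      * uinv (1 - ?z * ?x * ?y * ?x * ?y) * uinv (1 - ?z * ?x * ?y) * w13 * w23 * iy * iz"
    by (simp add: arg_cong[OF assms, of factor_order] words factor_series_simps Gens_members
        mult.assoc del: One_nat_def)
  also have "\<dots> = series (Wgrp t)"
    by (rule right_inverse_eq_product_632[OF orders alternating_inverse_sum_mult_series_Wgrp,
        symmetric])
      (use invertible_one_minus_wword[of 1] invertible_one_minus_wword[of 2] in
        \<open>simp_all add: words mult.assoc del: One_nat_def\<close>)
  finally show ?thesis .
qed

lemma ps_prod_factor_order: "ps_prod (map (factor t \<rho>) (factor_order t)) = ser \<rho> (Wgrp t)"
proof -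
  have "map (factor t \<rho>) (factor_order t) = map coeffs (map factor_series (factor_order t))"
    using set_factor_order by (simp add: factor_eq_coeffs)
  moreover have "prod_list (map factor_series (factor_order t)) = series (Wgrp t)"
    by (rule afftype.exhaust[of t])
      (rule prod_factor_series_TA2 prod_factor_series_TC2 prod_factor_series_TG2, assumption)+
  ultimately show ?thesis
    by (simp only: ps_prod_coeffs coeffs_series[OF subset_refl])
qed

end

theorem theorem3p2:
  fixes t :: afftype
    and scale :: "'k::field \<Rightarrow> 'v::ab_group_add \<Rightarrow> 'v"
    and q :: 'k
    and \<rho> :: "nat list set \<Rightarrow> 'v \<Rightarrow> 'v"
  assumes "vector_space scale"
    and "hecke_rep t scale q \<rho>"
  shows "\<exists>L. distinct L \<and> set L = factor_index \<and>
             ps_prod (map (factor t \<rho>) L) = ser \<rho> (Wgrp t)"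
proof (intro exI conjI)
  interpret braid_rep t \<rho>
    by (rule braid_rep_if_hecke_rep[OF assms(2)])
  show "distinct (factor_order t)"
    by (rule distinct_factor_order)
  show "set (factor_order t) = factor_index"
    by (rule set_factor_order)
  show "ps_prod (map (factor t \<rho>) (factor_order t)) = ser \<rho> (Wgrp t)"
    by (rule ps_prod_factor_order)
qed

end
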